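(* Let $k\subset\mathbb S^3$ be a knot with group $\pi=\pi_1(\mathbb S^3\setminus k)$ given by a Wirtinger presentation $\langle x_0,x_1,\ldots,x_n\mid r_1,\ldots,r_n\rangle$, let $\gamma:\pi\to \mathrm{GL}_N\mathbb C$ be a representation, and let $\pi_\gamma$ be the Crowell group of $k$ with respect to $\gamma$. Let $D_{\gamma,r}(t)$ ($r\ge 1$) be the polynomials associated with $\gamma$ as in the context, and write $D_\gamma(t)=D_{\gamma,1}(t)$. Then: (1) For any $\alpha\in\mathbb C^*$, the dimension over $\mathbb C$ of $\mathrm{Hom}(\pi_\gamma,\mathcal D_N)^0_\alpha$ (identified with a linear subspace of $\mathbb C^{nN}$) is equal to $\max\{r\mid D_{\gamma,r}(\alpha^{-1})=0\}$. (2) When $\alpha\in\mathbb C^*$ is a zero of an irreducible factor of $D_\gamma(t)$ that does not occur in $D_{\gamma,2}(t)$, any two nontrivial representations in $\mathrm{Hom}(\pi_\gamma,\mathcal D_N)^0_\alpha$ are conjugate in $\mathcal D_N$. Here nontrivial means that the vector in $\mathbb C^{nN}$ corresponding to the representation is nonzero.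
   Context: Wirtinger presentation. The $x_i$ are the meridian generators coming from the arcs of a diagram of $k$. Every Wirtinger relation has the form $x_ix_j=x_kx_i$; any one relation is a consequence of the others, so one of them is omitted, leaving $n$ relations for the $n+1$ generators. Twisted Alexander matrix and polynomials. Write $X_i=\gamma(x_i)$ and $\Lambda=\mathbb C[t^{\pm1}]$. For each of the $n$ Wirtinger relations $x_ix_j=x_kx_i$ consider the relation $$x_i+(tX_i)x_j=x_k+(tX_k)x_i .$$ Together with $x_0=0$, these present the based $\gamma$-twisted Alexander module, with generators $x_1,\ldots,x_n$ over the ring of $N\times N$ matrices over $\Lambda$. Its presentation matrix $M_\gamma$ is the $n\times n$ matrix of $N\times N$ blocks, regarded as an $nN\times nN$ matrix over $\Lambda$, whose block row for the relation above is the list of coefficients of $x_1,\ldots,x_n$ in $(I-tX_k)x_i+tX_ix_j-x_k$ (coefficients are added when indices coincide, and the $x_0$ coefficient is discarded). For $1\le r\le nN$, $D_{\gamma,r}(t)\in\Lambda$ is the greatest common divisor of all $(nN-r+1)\times(nN-r+1)$ minors of $M_\gamma$ (it is $0$ if all of these minors are $0$), well defined up to units of $\Lambda$; for $r>nN$ set $D_{\gamma,r}(t)=1$. The maximum of the empty set is taken to be $0$. Derived group and Crowell group. Given a right action of a group $G$ on a set $S$, written $(s,g)\mapsto sg$, its derived group $\tilde G$ is the group with generators ${}^sg$ ($s\in S$, $g\in G$) and relations ${}^s(gh)=({}^sg)({}^{sg}h)$ for all $s\in S$ and $g,h\in G$. Put $S=\mathrm{Im}\,\gamma\subset\mathrm{GL}_N\mathbb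 C$, on which $\pi$ acts by $s\cdot g=s\gamma(g)$. The Crowell group $\pi_\gamma$ (also denoted $\tilde\pi$) of $k$ with respect to $\gamma$ is the derived group of this action. $S$-groups. An $S$-group is a group $H$ with a map $S\times H\to H$, $(s,h)\mapsto sh$, such that $h\mapsto sh$ is an endomorphism for each $s\in S$. An $S$-group representation (homomorphism) $\delta:H\to H'$ between $S$-groups is a group homomorphism with $\delta(sh)=s\,\delta(h)$ for all $s\in S$, $h\in H$. The group $\pi_\gamma$ is an $S$-group via $s\,({}^tg)={}^{st}g$. The element ${}^e x_i\in\pi_\gamma$, where $e\in S$ is the identity matrix, is denoted simply by $x_i$; the elements $x_0,\ldots,x_n$ generate $\pi_\gamma$ as an $S$-group. Dilations. A dilation of $\mathbb C^N$ is a map $d:\mathbb C^N\to\mathbb C^N$ of the form $d(z)=\alpha z+b$ with $\alpha\in\mathbb C^*=\mathbb C\setminus\{0\}$ (the dilation ratio, or dilation factor) and $b\in\mathbb C^N$. Dilations form a group $\mathcal D_N$ under composition, where products are read from left to right: $d_1d_2$ means first apply $d_1$, then $d_2$, so $(d_1d_2)(z)=d_2(d_1(z))$. $\mathrm{GL}_N\mathbb C$ acts on the left on $\mathcal D_N$ by letting $A$ send $z\mapsto\alpha z+b$ to $z\mapsto\alpha z+Ab$; restricting this action to $S$ makes $\mathcal D_N$ an $S$-group. Two representations $\delta,\delta'$ into $\mathcal D_N$ are conjugate in $\mathcal D_N$ if there is $d\in\mathcal D_N$ with $\delta'(g)=d^{-1}\delta(g)d$ for all $g\in\pi_\gamma$.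 Representation space. For $\alpha\in\mathbb C^*$, $\mathrm{Hom}(\pi_\gamma,\mathcal D_N)^0_\alpha$ is the set of $S$-group representations $\delta:\pi_\gamma\to\mathcal D_N$ such that each $\delta(x_i)$ ($0\le i\le n$) has the form $z\mapsto\alpha z+b_i$ with the given ratio $\alpha$, and such that $\delta$ is based, i.e. $b_0=0$. Such a $\delta$ is uniquely determined by $(b_1,\ldots,b_n)\in(\mathbb C^N)^n\cong\mathbb C^{nN}$; the set of vectors that arise is a linear subspace of $\mathbb C^{nN}$, with which $\mathrm{Hom}(\pi_\gamma,\mathcal D_N)^0_\alpha$ is identified.
   Formalization: In part (2) the condition is that α^{-1}, rather than α, is a zero of the irreducible factor of D_γ(t) not occurring in D_{γ,2}(t); with α itself the claim fails for some non-reciprocal γ (e.g. N=1, k=3_1#3_1#4_1). Also N≥1 is assumed. *)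

theory Defs
  imports
    "HOL-Analysis.Homotopy"
    "HOL-Analysis.Derivative"
    "HOL-Library.Poly_Mapping"
    "HOL-Computational_Algebra.Factorial_Ring"
    "Jordan_Normal_Form.Determinant"
    "Jordan_Normal_Form.DL_Submatrix"
    "Jordan_Normal_Form.VS_Connect"
begin

section \<open>Groups given by generators and relations\<close>

text \<open>A letter \<open>(True, x)\<close> stands for \<open>x\<close>, a letter \<open>(False, x)\<close> for its inverse.\<close>

type_synonym 'a word = "(bool \<times> 'a) list"

definition words :: "'a set \<Rightarrow> 'a word set" where
  "words X = lists (UNIV \<times> X)"

inductive pres_eq :: "'a set \<Rightarrow> ('a word \<times> 'a word) set \<Rightarrow> 'a word \<Rightarrow> 'a word \<Rightarrow> bool"
  for X R where
  refl: "w \<in> words X \<Longrightarrow> pres_eq X R w w"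
| sym: "pres_eq X R v w \<Longrightarrow> pres_eq X R w v"
| trans: "pres_eq X R u v \<Longrightarrow> pres_eq X R v w \<Longrightarrow> pres_eq X R u w"
| cancel: "u \<in> words X \<Longrightarrow> v \<in> words X \<Longrightarrow> x \<in> X \<Longrightarrow>
     pres_eq X R (u @ [(b, x), (\<not> b, x)] @ v) (u @ v)"
| rel: "u \<in> words X \<Longrightarrow> v \<in> words X \<Longrightarrow> (l, r) \<in> R \<Longrightarrow> l \<in> words X \<Longrightarrow> r \<in> words X \<Longrightarrow>
     pres_eq X R (u @ l @ v) (u @ r @ v)"

definition word_class :: "'a set \<Rightarrow> ('a word \<times> 'a word) set \<Rightarrow> 'a word \<Rightarrow> 'a word set" where
  "word_class X R w = {v. pres_eq X R w v}"

definition presented_group :: "'a set \<Rightarrow> ('a word \<times> 'a word) set \<Rightarrow> 'a word set monoid" where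
  "presented_group X R =
     \<lparr>carrier = word_class X R ` words X,
      mult = (\<lambda>A B. \<Union>v\<in>A. \<Union>w\<in>B. word_class X R (v @ w)),
      one = word_class X R []\<rparr>"

definition word_val :: "('g, 'b) monoid_scheme \<Rightarrow> ('a \<Rightarrow> 'g) \<Rightarrow> 'a word \<Rightarrow> 'g" where
  "word_val G x w = foldr (\<lambda>(b, a) g. (if b then x a else inv\<^bsub>G\<^esub> x a) \<otimes>\<^bsub>G\<^esub> g) w \<one>\<^bsub>G\<^esub>"

text \<open>\<open>G\<close> is presented by the generators \<open>x a\<close> (\<open>a \<in> I\<close>) and the relations \<open>R\<close> between them,
  i.e. evaluation of words induces an isomorphism from \<open>presented_group I R\<close> onto \<open>G\<close>.\<close>

definition has_presentation ::
  "('g, 'b) monoid_scheme \<Rightarrow> 'a set \<Rightarrow> ('a \<Rightarrow> 'g) \<Rightarrow> ('a word \<times> 'a word) set \<Rightarrow> bool" where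
  "has_presentation G I x R \<longleftrightarrow>
     x \<in> I \<rightarrow> carrier G \<and>
     word_val G x ` words I = carrier G \<and>
     (\<forall>v\<in>words I. \<forall>w\<in>words I. word_val G x v = word_val G x w \<longleftrightarrow> pres_eq I R v w)"


section \<open>Knots, diagrams and Wirtinger presentations\<close>

definition loop_class :: "'a::topological_space set \<Rightarrow> (real \<Rightarrow> 'a) \<Rightarrow> (real \<Rightarrow> 'a) set" where
  "loop_class U f = {g. homotopic_paths U f g}"

definition fundamental_group ::
  "'a::topological_space set \<Rightarrow> 'a \<Rightarrow> (real \<Rightarrow> 'a) set monoid" where
  "fundamental_group U p =
     \<lparr>carrier = loop_class U `
        {f. path f \<and> path_image f \<subseteq> U \<and> pathstart f = p \<and> pathfinish f = p},
      mult = (\<lambda>A B. \<Union>f\<in>A. \<Union>g\<in>B. loop_class U (f +++ g)),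
      one = loop_class U (\<lambda>_. p)\<rparr>"

abbreviation S3 :: "(complex \<times> complex) set" where
  "S3 \<equiv> sphere 0 1"

definition knot :: "(complex \<times> complex) set \<Rightarrow> bool" where
  "knot k \<longleftrightarrow> k \<subseteq> S3 \<and> k homeomorphic sphere (0 :: complex) 1"

text \<open>Three-space is \<open>complex \<times> real\<close>: diagrams are drawn in the plane \<open>complex\<close>, and the real
  coordinate is the height. It is identified with \<open>S3\<close> minus the point \<open>(0, \<i>)\<close> by inverse
  stereographic projection.\<close>

definition stereo :: "complex \<times> real \<Rightarrow> complex \<times> complex" where
  "stereo y = (let q = (norm y)\<^sup>2 in
     ((2 / (1 + q)) *\<^sub>R fst y, Complex (2 * snd y / (1 + q)) ((q - 1) / (1 + q))))"

definition ambient_isotopy :: "(real \<Rightarrow> complex \<times> complex \<Rightarrow> complex \<times> complex) \<Rightarrow> bool" where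
  "ambient_isotopy H \<longleftrightarrow>
     continuous_on ({0..1} \<times> S3) (\<lambda>(t, y). H t y) \<and>
     (\<forall>t\<in>{0..1}. \<exists>g. homeomorphism S3 S3 (H t) g) \<and>
     (\<forall>y\<in>S3. H 0 y = y)"

definition plane_tangent :: "(real \<Rightarrow> complex \<times> real) \<Rightarrow> real \<Rightarrow> complex" where
  "plane_tangent c t = fst (vector_derivative c (at t))"

text \<open>\<open>turn c s t > 0\<close> iff, in the plane, the tangent at \<open>s\<close> points to the left of the oriented
  tangent at \<open>t\<close>.\<close>

definition turn :: "(real \<Rightarrow> complex \<times> real) \<Rightarrow> real \<Rightarrow> real \<Rightarrow> real" where
  "turn c s t = Im (cnj (plane_tangent c t) * plane_tangent c s)"

text \<open>A simple closed \<open>C\<^sup>1\<close> curve, parametrised by the reals with period 1, whose projection to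
  the plane is an immersion having only transverse double points.\<close>

definition knot_diagram :: "(real \<Rightarrow> complex \<times> real) \<Rightarrow> bool" where
  "knot_diagram c \<longleftrightarrow>
     (\<forall>s t. c s = c t \<longleftrightarrow> s - t \<in> \<int>) \<and>
     (\<forall>t. c differentiable at t) \<and>
     continuous_on UNIV (\<lambda>t. vector_derivative c (at t)) \<and>
     (\<forall>t. plane_tangent c t \<noteq> 0) \<and>
     (\<forall>s t. fst (c s) = fst (c t) \<and> s - t \<notin> \<int> \<longrightarrow> turn c s t \<noteq> 0) \<and>
     (\<forall>s t u. fst (c s) = fst (c t) \<and> fst (c t) = fst (c u) \<longrightarrow>
        s - t \<in> \<int> \<or> t - u \<in> \<int> \<or> s - u \<in> \<int>)"

definition passes_under :: "(real \<Rightarrow> complex \<times> real) \<Rightarrow> real \<Rightarrow> real \<Rightarrow> bool" where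
  "passes_under c s t \<longleftrightarrow> fst (c s) = fst (c t) \<and> snd (c s) < snd (c t)"

text \<open>Crossings are represented by the parameters of their lower strands.\<close>

definition crossings :: "(real \<Rightarrow> complex \<times> real) \<Rightarrow> real set" where
  "crossings c = {s \<in> {0..<1}. \<exists>t. passes_under c s t}"

definition diagram_arcs :: "(real \<Rightarrow> complex \<times> real) \<Rightarrow> (complex \<times> real) set set" where
  "diagram_arcs c = components (range c - c ` crossings c)"

text \<open>From the base point \<open>P\<close> (above the curve) straight to a point over the left-hand side of
  the strand at \<open>c t\<close>, vertically down, horizontally below the strand to its right-hand side,
  vertically up to the height of \<open>P\<close>, and back to \<open>P\<close>; \<open>e\<close> is the size of the detour.\<close>

definition meridian_loop ::
  "(real \<Rightarrow> complex \<times> real) \<Rightarrow> complex \<times> real \<Rightarrow> real \<Rightarrow> real \<Rightarrow> real \<Rightarrow> complex \<times> real" where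
  "meridian_loop c P t e =
     (let l = fst (c t) + of_real e * (\<i> * plane_tangent c t);
          r = fst (c t) - of_real e * (\<i> * plane_tangent c t);
          top = snd P;
          low = snd (c t) - e
      in linepath P (l, top) +++ linepath (l, top) (l, low) +++ linepath (l, low) (r, low) +++
         linepath (r, low) (r, top) +++ linepath (r, top) P)"

text \<open>At the crossing \<open>s\<close> the upper strand lies on the arc \<open>A i\<close>, and the lower strand passes
  between the arc \<open>A j\<close> to the right and the arc \<open>A k\<close> to the left of the upper strand. With the
  meridians above, the Wirtinger relation at the crossing is then
  \<open>x\<^sub>i x\<^sub>j = x\<^sub>k x\<^sub>i\<close>, whatever the orientation of the lower strand.\<close>

definition crossing_arcs ::
  "(real \<Rightarrow> complex \<times> real) \<Rightarrow> (nat \<Rightarrow> (complex \<times> real) set) \<Rightarrow> real \<Rightarrow> nat \<Rightarrow> nat \<Rightarrow> nat \<Rightarrow> bool"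
  where
  "crossing_arcs c A s i j k \<longleftrightarrow>
     (\<exists>t. passes_under c s t \<and> c t \<in> A i \<and>
        (\<forall>\<^sub>F e in at_right 0. c (s - sgn (turn c s t) * e) \<in> A j) \<and>
        (\<forall>\<^sub>F e in at_right 0. c (s + sgn (turn c s t) * e) \<in> A k))"

definition wirtinger_relators :: "nat \<Rightarrow> (nat \<Rightarrow> nat \<times> nat \<times> nat) \<Rightarrow> (nat word \<times> nat word) set"
  where
  "wirtinger_relators n \<rho> =
     {([(True, i), (True, j)], [(True, k), (True, i)]) | i j k l. l \<in> {1..n} \<and> \<rho> l = (i, j, k)}"

text \<open>\<open>\<pi>\<^sub>1(S3 - k, p)\<close> has the Wirtinger presentation with generators \<open>x 0, \<dots>, x n\<close> and
  relations \<open>x\<^sub>i x\<^sub>j = x\<^sub>k x\<^sub>i\<close>, where \<open>(i, j, k) = \<rho> l\<close> and \<open>1 \<le> l \<le> n\<close>, coming from a diagram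
  \<open>c\<close> of \<open>k\<close>. The relation at the crossing \<open>s\<^sub>0\<close> is omitted; a diagram without crossings has a
  single arc and no relation to omit.\<close>

definition wirtinger_presentation ::
  "(complex \<times> complex) set \<Rightarrow> complex \<times> complex \<Rightarrow> nat \<Rightarrow>
   (nat \<Rightarrow> (real \<Rightarrow> complex \<times> complex) set) \<Rightarrow> (nat \<Rightarrow> nat \<times> nat \<times> nat) \<Rightarrow> bool" where
  "wirtinger_presentation k p n x \<rho> \<longleftrightarrow>
     (\<exists>c H P A s s\<^sub>0.
        knot_diagram c \<and> ambient_isotopy H \<and> H 1 ` stereo ` range c = k \<and>
        (\<forall>t. snd (c t) < snd P) \<and> p = H 1 (stereo P) \<and>
        bij_betw A {0..n} (diagram_arcs c) \<and>
        (\<forall>i\<le>n. \<forall>t. c t \<in> A i \<longrightarrow>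
           (\<forall>\<^sub>F e in at_right 0.
              x i = loop_class (S3 - k) (H 1 \<circ> stereo \<circ> meridian_loop c P t e))) \<and>
        (s\<^sub>0 \<in> crossings c \<or> crossings c = {}) \<and>
        bij_betw s {1..n} (crossings c - {s\<^sub>0}) \<and>
        (\<forall>l\<in>{1..n}. case \<rho> l of (i, j, k) \<Rightarrow>
           i \<le> n \<and> j \<le> n \<and> k \<le> n \<and> crossing_arcs c A (s l) i j k)) \<and>
     has_presentation (fundamental_group (S3 - k) p) {0..n} x (wirtinger_relators n \<rho>)"


section \<open>The twisted Alexander matrix and polynomials\<close>

text \<open>The Laurent polynomial ring \<open>\<complex>[t, t\<^sup>-\<^sup>1]\<close>, as the group ring of the integers.\<close>

type_synonym laurent = "int \<Rightarrow>\<^sub>0 complex"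

definition laurent_const :: "complex \<Rightarrow> laurent" where
  "laurent_const a = Poly_Mapping.single 0 a"

definition laurent_t :: laurent where
  "laurent_t = Poly_Mapping.single 1 1"

definition laurent_eval :: "laurent \<Rightarrow> complex \<Rightarrow> complex" where
  "laurent_eval f a = (\<Sum>m\<in>Poly_Mapping.keys f. Poly_Mapping.lookup f m * a powi m)"

text \<open>The coefficient of \<open>x\<^sub>l\<close> in \<open>(I - t X\<^sub>k) x\<^sub>i + t X\<^sub>i x\<^sub>j - x\<^sub>k\<close>.\<close>

definition relation_block ::
  "nat \<Rightarrow> (nat \<Rightarrow> complex mat) \<Rightarrow> nat \<times> nat \<times> nat \<Rightarrow> nat \<Rightarrow> laurent mat" where
  "relation_block N X = (\<lambda>(i, j, k) l.
     (if l = i then 1\<^sub>m N - laurent_t \<cdot>\<^sub>m map_mat laurent_const (X k) else 0\<^sub>m N N) +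
     (if l = j then laurent_t \<cdot>\<^sub>m map_mat laurent_const (X i) else 0\<^sub>m N N) -
     (if l = k then 1\<^sub>m N else 0\<^sub>m N N))"

definition twisted_matrix ::
  "nat \<Rightarrow> nat \<Rightarrow> (nat \<Rightarrow> complex mat) \<Rightarrow> (nat \<Rightarrow> nat \<times> nat \<times> nat) \<Rightarrow> laurent mat" where
  "twisted_matrix N n X \<rho> = Matrix.mat (n * N) (n * N) (\<lambda>(u, v).
     relation_block N X (\<rho> (u div N + 1)) (v div N + 1) $$ (u mod N, v mod N))"

definition minors :: "nat \<Rightarrow> 'a::comm_ring_1 mat \<Rightarrow> 'a set" where
  "minors m M = {Determinant.det (submatrix M I J) | I J.
     I \<subseteq> {..<dim_row M} \<and> J \<subseteq> {..<dim_col M} \<and> card I = m \<and> card J = m}"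

definition is_gcd_of :: "'a::comm_semiring_1 \<Rightarrow> 'a set \<Rightarrow> bool" where
  "is_gcd_of d A \<longleftrightarrow> (\<forall>a\<in>A. d dvd a) \<and> (\<forall>e. (\<forall>a\<in>A. e dvd a) \<longrightarrow> e dvd d)"

text \<open>\<open>D r\<close> is a choice of the polynomial \<open>D\<^sub>\<gamma>\<^sub>,\<^sub>r\<close>, which is only determined up to units.\<close>

definition twisted_polynomials ::
  "nat \<Rightarrow> nat \<Rightarrow> (nat \<Rightarrow> complex mat) \<Rightarrow> (nat \<Rightarrow> nat \<times> nat \<times> nat) \<Rightarrow> (nat \<Rightarrow> laurent) \<Rightarrow> bool"
  where
  "twisted_polynomials N n X \<rho> D \<longleftrightarrow>
     (\<forall>r\<in>{1..n * N}. is_gcd_of (D r) (minors (n * N - r + 1) (twisted_matrix N n X \<rho>))) \<and>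
     (\<forall>r>n * N. D r = 1)"


section \<open>The Crowell group\<close>

definition GL :: "nat \<Rightarrow> complex mat monoid" where
  "GL N = \<lparr>carrier = {A \<in> carrier_mat N N. invertible_mat A}, mult = (*), one = 1\<^sub>m N\<rparr>"

definition derived_relators ::
  "('g, 'b) monoid_scheme \<Rightarrow> 's set \<Rightarrow> ('s \<Rightarrow> 'g \<Rightarrow> 's) \<Rightarrow> (('s \<times> 'g) word \<times> ('s \<times> 'g) word) set"
  where
  "derived_relators G S act =
     {([(True, (s, g \<otimes>\<^bsub>G\<^esub> h))], [(True, (s, g)), (True, (act s g, h))]) | s g h.
        s \<in> S \<and> g \<in> carrier G \<and> h \<in> carrier G}"

definition derived_group ::
  "('g, 'b) monoid_scheme \<Rightarrow> 's set \<Rightarrow> ('s \<Rightarrow> 'g \<Rightarrow> 's) \<Rightarrow> ('s \<times> 'g) word set monoid" where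
  "derived_group G S act = presented_group (S \<times> carrier G) (derived_relators G S act)"

text \<open>The class of the generator \<open>(s, g)\<close>, written \<open>\<^sup>sg\<close> in the literature.\<close>

definition derived_gen ::
  "('g, 'b) monoid_scheme \<Rightarrow> 's set \<Rightarrow> ('s \<Rightarrow> 'g \<Rightarrow> 's) \<Rightarrow> 's \<Rightarrow> 'g \<Rightarrow> ('s \<times> 'g) word set" where
  "derived_gen G S act s g = word_class (S \<times> carrier G) (derived_relators G S act) [(True, (s, g))]"

abbreviation rep_image :: "('g, 'b) monoid_scheme \<Rightarrow> ('g \<Rightarrow> complex mat) \<Rightarrow> complex mat set" where
  "rep_image G \<gamma> \<equiv> \<gamma> ` carrier G"

definition crowell_group ::
  "('g, 'b) monoid_scheme \<Rightarrow> ('g \<Rightarrow> complex mat) \<Rightarrow> (complex mat \<times> 'g) word set monoid" where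
  "crowell_group G \<gamma> = derived_group G (rep_image G \<gamma>) (\<lambda>s g. s * \<gamma> g)"

definition crowell_gen ::
  "('g, 'b) monoid_scheme \<Rightarrow> ('g \<Rightarrow> complex mat) \<Rightarrow> complex mat \<Rightarrow> 'g \<Rightarrow>
   (complex mat \<times> 'g) word set" where
  "crowell_gen G \<gamma> = derived_gen G (rep_image G \<gamma>) (\<lambda>s g. s * \<gamma> g)"

text \<open>The endomorphism given by \<open>s (\<^sup>tg) = \<^sup>s\<^sup>tg\<close>, applied to a class of words.\<close>

definition crowell_act ::
  "('g, 'b) monoid_scheme \<Rightarrow> ('g \<Rightarrow> complex mat) \<Rightarrow> complex mat \<Rightarrow>
   (complex mat \<times> 'g) word set \<Rightarrow> (complex mat \<times> 'g) word set" where
  "crowell_act G \<gamma> s C =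
     (\<Union>w\<in>C. word_class (rep_image G \<gamma> \<times> carrier G)
        (derived_relators G (rep_image G \<gamma>) (\<lambda>s g. s * \<gamma> g))
        (map (\<lambda>(b, (t, g)). (b, (s * t, g))) w))"


section \<open>Dilations and the representation space\<close>

text \<open>Maps on \<open>\<complex>\<^sup>N\<close> are functions on \<open>carrier_vec N\<close> that are \<open>undefined\<close> elsewhere.\<close>

definition dilation :: "nat \<Rightarrow> complex \<Rightarrow> complex vec \<Rightarrow> complex vec \<Rightarrow> complex vec" where
  "dilation N \<alpha> b = (\<lambda>z\<in>carrier_vec N. \<alpha> \<cdot>\<^sub>v z + b)"

text \<open>Products are read from left to right, hence the swapped arguments of \<open>compose\<close>.\<close>

definition dilation_group :: "nat \<Rightarrow> (complex vec \<Rightarrow> complex vec) monoid" where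
  "dilation_group N =
     \<lparr>carrier = {dilation N \<alpha> b | \<alpha> b. \<alpha> \<noteq> 0 \<and> b \<in> carrier_vec N},
      mult = (\<lambda>d\<^sub>1 d\<^sub>2. compose (carrier_vec N) d\<^sub>2 d\<^sub>1),
      one = (\<lambda>z\<in>carrier_vec N. z)\<rparr>"

text \<open>If \<open>d\<close> is \<open>z \<mapsto> \<alpha> z + b\<close>, then \<open>d z - d 0 = \<alpha> z\<close> and \<open>d 0 = b\<close>, so this is
  \<open>z \<mapsto> \<alpha> z + A b\<close>.\<close>

definition dilation_act ::
  "nat \<Rightarrow> complex mat \<Rightarrow> (complex vec \<Rightarrow> complex vec) \<Rightarrow> complex vec \<Rightarrow> complex vec" where
  "dilation_act N A d = (\<lambda>z\<in>carrier_vec N. (d z - d (0\<^sub>v N)) + A *\<^sub>v d (0\<^sub>v N))"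

definition S_hom ::
  "'s set \<Rightarrow> ('g, 'b) monoid_scheme \<Rightarrow> ('s \<Rightarrow> 'g \<Rightarrow> 'g) \<Rightarrow> ('h, 'c) monoid_scheme \<Rightarrow>
   ('s \<Rightarrow> 'h \<Rightarrow> 'h) \<Rightarrow> ('g \<Rightarrow> 'h) set" where
  "S_hom S G actG H actH =
     {\<delta> \<in> hom G H. \<forall>s\<in>S. \<forall>g\<in>carrier G. \<delta> (actG s g) = actH s (\<delta> g)}"

definition based_reps ::
  "nat \<Rightarrow> ('g, 'b) monoid_scheme \<Rightarrow> ('g \<Rightarrow> complex mat) \<Rightarrow> nat \<Rightarrow> (nat \<Rightarrow> 'g) \<Rightarrow> complex \<Rightarrow>
   ((complex mat \<times> 'g) word set \<Rightarrow> complex vec \<Rightarrow> complex vec) set" where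
  "based_reps N G \<gamma> n x \<alpha> =
     {\<delta> \<in> S_hom (rep_image G \<gamma>) (crowell_group G \<gamma>) (crowell_act G \<gamma>)
              (dilation_group N) (dilation_act N) \<inter> extensional (carrier (crowell_group G \<gamma>)).
        (\<forall>i\<le>n. \<exists>b\<in>carrier_vec N. \<delta> (crowell_gen G \<gamma> (1\<^sub>m N) (x i)) = dilation N \<alpha> b) \<and>
        \<delta> (crowell_gen G \<gamma> (1\<^sub>m N) (x 0)) = dilation N \<alpha> (0\<^sub>v N)}"

text \<open>The vector \<open>(b\<^sub>1, \<dots>, b\<^sub>n)\<close> of a based representation, \<open>b\<^sub>i\<close> being the image of the origin
  under the dilation assigned to \<open>x i\<close>.\<close>

definition rep_vec ::
  "nat \<Rightarrow> ('g, 'b) monoid_scheme \<Rightarrow> ('g \<Rightarrow> complex mat) \<Rightarrow> nat \<Rightarrow> (nat \<Rightarrow> 'g) \<Rightarrow>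
   ((complex mat \<times> 'g) word set \<Rightarrow> complex vec \<Rightarrow> complex vec) \<Rightarrow> complex vec" where
  "rep_vec N G \<gamma> n x \<delta> = Matrix.vec (n * N) (\<lambda>u.
     \<delta> (crowell_gen G \<gamma> (1\<^sub>m N) (x (u div N + 1))) (0\<^sub>v N) $ (u mod N))"

definition conjugate_reps ::
  "('g, 'b) monoid_scheme \<Rightarrow> ('h, 'c) monoid_scheme \<Rightarrow> ('g \<Rightarrow> 'h) \<Rightarrow> ('g \<Rightarrow> 'h) \<Rightarrow> bool" where
  "conjugate_reps G H \<delta> \<delta>' \<longleftrightarrow>
     (\<exists>d\<in>carrier H. \<forall>g\<in>carrier G. \<delta>' g = inv\<^bsub>H\<^esub> d \<otimes>\<^bsub>H\<^esub> \<delta> g \<otimes>\<^bsub>H\<^esub> d)"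

definition is_linear_subspace :: "nat \<Rightarrow> complex vec set \<Rightarrow> bool" where
  "is_linear_subspace m V \<longleftrightarrow> VectorSpace.subspace class_ring V (module_vec TYPE(complex) m)"

definition linear_dim :: "nat \<Rightarrow> complex vec set \<Rightarrow> nat" where
  "linear_dim m V = vectorspace.dim class_ring ((module_vec TYPE(complex) m)\<lparr>carrier := V\<rparr>)"

end

theory Submission
  imports
    Defs
    "Jordan_Normal_Form.DL_Rank_Submatrix"
    "Jordan_Normal_Form.Matrix_Kernel"
begin

text \<open>Since an \<open>S\<close>-group representation satisfies \<open>\<delta>(\<^sup>sg) = s \<delta>(\<^sup>eg)\<close>, it is determined by the ratio
  \<open>a(g)\<close> and the translation part \<open>\<beta>(g)\<close> of \<open>\<delta>(\<^sup>eg)\<close>, and the relations of the derived group say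
  exactly that \<open>g \<mapsto> (a(g), \<gamma>(g), \<beta>(g))\<close> is a homomorphism from \<open>\<pi>\<close> to a semidirect product,
  i.e. \<open>a\<close> is multiplicative and \<open>\<beta>(gh) = a(h) \<beta>(g) + \<gamma>(g) \<beta>(h)\<close>. By the Wirtinger presentation, such a
  homomorphism with \<open>a(x\<^sub>i) = \<alpha>\<close> and \<open>\<beta>(x\<^sub>i) = b\<^sub>i\<close> exists iff
  \<open>\<alpha> b\<^sub>i + X\<^sub>i b\<^sub>j = \<alpha> b\<^sub>k + X\<^sub>k b\<^sub>i\<close> for every relation, i.e. iff \<open>b\<close> lies in the kernel of the twisted
  Alexander matrix evaluated at \<open>\<alpha>\<^sup>-\<^sup>1\<close>. The nullity of that matrix is read off its vanishing minors,
  and by the factor theorem in \<open>\<complex>[t, t\<^sup>-\<^sup>1]\<close> a greatest common divisor vanishes at \<open>\<alpha>\<^sup>-\<^sup>1\<close> iff all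
  the minors do. In (2) the nullity is at most 1, so \<open>b' = c b\<close>, and conjugation by \<open>z \<mapsto> c z\<close> takes one
  representation to the other.\<close>

section \<open>Presented groups\<close>

text \<open>Two existence statements are hidden in the correspondence: passing from a homomorphism
  back to a representation of the Crowell group, and from a kernel vector to a homomorphism. Both
  are instances of von Dyck's theorem, which is why a presented group is shown to have its defining
  presentation: the same extension and uniqueness lemmas then serve the Crowell group and the knot
  group. The law for \<open>\<beta>\<close> is asymmetric because products of dilations are read
  from left to right: the ratio of the later factor multiplies the earlier translation, while the
  matrix of the earlier factor reaches the later translation through the twist in the derived
  relation. On the side of linear algebra the delicate direction is to produce a nonvanishing minor
  of the size of the rank. It is obtained by choosing independent columns and then independent rows,
  with rank-nullity taking the place of the equality of row and column rank.\<close>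

lemma words_simps [simp]:
  "[] \<in> words X" "(b, x) # w \<in> words X \<longleftrightarrow> x \<in> X \<and> w \<in> words X"
  "v @ w \<in> words X \<longleftrightarrow> v \<in> words X \<and> w \<in> words X"
  by (auto simp: words_def)

lemma pres_eq_words: "pres_eq X R v w \<Longrightarrow> v \<in> words X \<and> w \<in> words X"
  by (induction rule: pres_eq.induct) auto

lemma pres_eq_append_left:
  "pres_eq X R v w \<Longrightarrow> u \<in> words X \<Longrightarrow> pres_eq X R (u @ v) (u @ w)"
proof (induction rule: pres_eq.induct)
  case (cancel a v x b)
  then show ?case using pres_eq.cancel[of "u @ a" X v x R b] by simp
next
  case (rel a v l r)
  then show ?case using pres_eq.rel[of "u @ a" X v l r R] by simp
next
  case (refl w)
  then show ?case by (simp add: pres_eq.refl)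
next
  case (sym v w)
  then show ?case by (simp add: pres_eq.sym)
next
  case (trans a v w)
  then show ?case using pres_eq.trans by blast
qed

lemma pres_eq_append_right:
  "pres_eq X R v w \<Longrightarrow> u \<in> words X \<Longrightarrow> pres_eq X R (v @ u) (w @ u)"
proof (induction rule: pres_eq.induct)
  case (cancel a v x b)
  then show ?case using pres_eq.cancel[of a X "v @ u" x R b] by simp
next
  case (rel a v l r)
  then show ?case using pres_eq.rel[of a X "v @ u" l r R] by simp
next
  case (refl w)
  then show ?case by (simp add: pres_eq.refl)
next
  case (sym v w)
  then show ?case by (simp add: pres_eq.sym)
next
  case (trans a v w)
  then show ?case using pres_eq.trans by blast
qed

lemma pres_eq_append:
  "pres_eq X R v v' \<Longrightarrow> pres_eq X R w w' \<Longrightarrow> pres_eq X R (v @ w) (v' @ w')"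
  by (meson pres_eq.trans pres_eq_append_left pres_eq_append_right pres_eq_words)

text \<open>Outside \<open>words X\<close> every class is empty, so two such classes coincide
  although \<open>pres_eq\<close> fails; membership of \<open>w\<close> excludes this by putting
  \<open>w\<close> in its own class.\<close>

lemma word_class_eq_iff:
  "w \<in> words X \<Longrightarrow> word_class X R v = word_class X R w \<longleftrightarrow> pres_eq X R v w"
  unfolding word_class_def set_eq_iff mem_Collect_eq
  by (metis pres_eq.refl pres_eq.sym pres_eq.trans)

lemma word_class_eqI: "pres_eq X R v w \<Longrightarrow> word_class X R v = word_class X R w"
  using pres_eq_words[of X R v w] by (simp add: word_class_eq_iff)

lemma word_class_self: "w \<in> words X \<Longrightarrow> w \<in> word_class X R w"
  by (simp add: word_class_def pres_eq.refl)

text \<open>The product of classes is a union over all representatives. Its terms are all the same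
  class because \<open>pres_eq\<close> is a congruence, and the union is not over an empty family
  since \<open>v\<close> and \<open>w\<close> represent their own classes.\<close>

lemma presented_mult:
  assumes "v \<in> words X" "w \<in> words X"
  shows "word_class X R v \<otimes>\<^bsub>presented_group X R\<^esub> word_class X R w = word_class X R (v @ w)"
proof -
  have eq: "word_class X R (v' @ w') = word_class X R (v @ w)"
    if "v' \<in> word_class X R v" "w' \<in> word_class X R w" for v' w'
  proof -
    have "pres_eq X R (v @ w) (v' @ w')"
      using that by (intro pres_eq_append) (auto simp: word_class_def)
    then show ?thesis by (rule word_class_eqI[symmetric])
  qed
  have "(\<Union>v'\<in>word_class X R v. \<Union>w'\<in>word_class X R w. word_class X R (v' @ w')) =
      (\<Union>v'\<in>word_class X R v. \<Union>w'\<in>word_class X R w. word_class X R (v @ w))"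
    by (intro SUP_cong HOL.refl eq)
  also have "\<dots> = word_class X R (v @ w)"
    using word_class_self[OF assms(1), of R] word_class_self[OF assms(2), of R] by auto
  finally show ?thesis by (simp add: presented_group_def)
qed

lemma carrier_presented: "carrier (presented_group X R) = word_class X R ` words X"
  by (simp add: presented_group_def)

lemma one_presented: "\<one>\<^bsub>presented_group X R\<^esub> = word_class X R []"
  by (simp add: presented_group_def)

definition word_inverse :: "'a word \<Rightarrow> 'a word" where
  "word_inverse w = rev (map (\<lambda>(b, x). (\<not> b, x)) w)"

lemma word_inverse_words [simp]: "word_inverse w \<in> words X \<longleftrightarrow> w \<in> words X"
  by (induction w) (auto simp: word_inverse_def)

lemma pres_eq_word_inverse:
  "w \<in> words X \<Longrightarrow> pres_eq X R (word_inverse w @ w) []"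
proof (induction w)
  case Nil
  then show ?case by (simp add: word_inverse_def pres_eq.refl)
next
  case (Cons a w)
  obtain b x where a: "a = (b, x)" by force
  \<comment> \<open>The rule \<open>cancel\<close> is used at the letter with sign
    \<open>\<not> b\<close>, since the inverse of the first letter ends up directly in front of
    it.\<close>
  have "pres_eq X R (word_inverse w @ [(\<not> b, x), (\<not> \<not> b, x)] @ w) (word_inverse w @ w)"
    using Cons.prems by (intro pres_eq.cancel) (auto simp: a)
  then show ?case
    using Cons pres_eq.trans by (fastforce simp: a word_inverse_def)
qed

lemma presented_group_is_group: "group (presented_group X R)"
proof (rule groupI)
  fix A assume "A \<in> carrier (presented_group X R)"
  then obtain w where w: "w \<in> words X" "A = word_class X R w" by (auto simp: carrier_presented)
  show "\<exists>B\<in>carrier (presented_group X R).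
      B \<otimes>\<^bsub>presented_group X R\<^esub> A = \<one>\<^bsub>presented_group X R\<^esub>"
    using w pres_eq_word_inverse[of w X R]
    by (intro bexI[of _ "word_class X R (word_inverse w)"])
      (auto simp: presented_mult one_presented carrier_presented word_class_eq_iff)
qed (auto simp: carrier_presented presented_mult one_presented)

section \<open>Evaluation of words and the universal property of a presentation\<close>

lemma word_val_Nil [simp]: "word_val G x [] = \<one>\<^bsub>G\<^esub>"
  and word_val_Cons [simp]:
    "word_val G x ((b, a) # w) = (if b then x a else inv\<^bsub>G\<^esub> x a) \<otimes>\<^bsub>G\<^esub> word_val G x w"
  by (simp_all add: word_val_def)

context group
begin

lemma word_val_closed:
  "x \<in> X \<rightarrow> carrier G \<Longrightarrow> w \<in> words X \<Longrightarrow> word_val G x w \<in> carrier G"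
  by (induction w) (auto simp: Pi_iff)

lemma word_val_append:
  "x \<in> X \<rightarrow> carrier G \<Longrightarrow> v \<in> words X \<Longrightarrow> w \<in> words X \<Longrightarrow>
    word_val G x (v @ w) = word_val G x v \<otimes> word_val G x w"
proof (induction v)
  case (Cons a v)
  then show ?case by (cases a) (auto simp: word_val_closed m_assoc Pi_iff)
qed (auto simp: word_val_closed)

text \<open>Soundness of the word calculus: a cancelled pair evaluates to the unit and a relator
  step exchanges equal values, so in any group satisfying the relations the value is constant on
  classes.\<close>

lemma pres_eq_word_val:
  assumes "x \<in> X \<rightarrow> carrier G"
    and "\<And>l r. (l, r) \<in> R \<Longrightarrow> l \<in> words X \<Longrightarrow> r \<in> words X \<Longrightarrow> word_val G x l = word_val G x r"
    and "pres_eq X R v w"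
  shows "word_val G x v = word_val G x w"
  using assms(3)
proof (induction rule: pres_eq.induct)
  case (cancel u v a b)
  then have a: "x a \<in> carrier G" using assms(1) by auto
  have "word_val G x ([(b, a), (\<not> b, a)] @ v) = word_val G x v"
    using cancel a assms(1) word_val_closed[of x X v] by (simp add: m_assoc[symmetric])
  then show ?case
    using cancel by (simp only: word_val_append[OF assms(1)] words_simps)
next
  case (rel u v l r)
  then show ?case using assms(1,2) by (auto simp: word_val_append)
qed auto

lemma hom_word_val:
  assumes "group H" "f \<in> hom G H" "x \<in> X \<rightarrow> carrier G" "w \<in> words X"
  shows "f (word_val G x w) = word_val H (f \<circ> x) w"
proof -
  interpret f: group_hom G H f
    using assms by (simp add: group_hom_def group_hom_axioms_def is_group)
  show ?thesis using assms(3,4)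
  proof (induction w)
    case (Cons a w)
    then show ?case by (cases a) (auto simp: word_val_closed Pi_iff)
  qed auto
qed

end

text \<open>The inverse of the class of a letter is the class of the inverse letter; the rest is
  multiplicativity. This makes a presented group an instance of \<open>has_presentation\<close>, so
  that the universal property applies to the Crowell group.\<close>

lemma word_class_eq_word_val:
  assumes "w \<in> words X"
  shows "word_class X R w = word_val (presented_group X R) (\<lambda>a. word_class X R [(True, a)]) w"
  using assms
proof (induction w)
  case (Cons a w)
  interpret P: group "presented_group X R" by (rule presented_group_is_group)
  obtain b x where a: "a = (b, x)" by force
  have x: "x \<in> X" and w: "w \<in> words X" using Cons.prems by (auto simp: a)
  have inv: "inv\<^bsub>presented_group X R\<^esub> word_class X R [(True, x)] = word_class X R [(False, x)]"
  proof (rule P.inv_equality)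
    show "word_class X R [(False, x)] \<otimes>\<^bsub>presented_group X R\<^esub> word_class X R [(True, x)]
        = \<one>\<^bsub>presented_group X R\<^esub>"
      using pres_eq.cancel[of "[]" X "[]" x R False] x
      by (simp add: presented_mult one_presented word_class_eq_iff)
  qed (use x in \<open>auto simp: carrier_presented\<close>)
  have "word_class X R (a # w)
      = word_class X R [a] \<otimes>\<^bsub>presented_group X R\<^esub> word_class X R w"
    using presented_mult[of "[a]" X w R] x w by (simp add: a)
  then show ?case using Cons.IH w by (cases b) (auto simp: a inv)
qed (simp add: one_presented)

text \<open>Von Dyck's theorem. The image of \<open>g\<close> is the value in \<open>H\<close> of
  some word for \<open>g\<close>; the choice does not matter, because two words for \<open>g\<close>
  are related by \<open>pres_eq\<close> and soundness holds in \<open>H\<close>.\<close>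

lemma has_presentation_extend:
  assumes "group G" "group H" "has_presentation G I x R" "f \<in> I \<rightarrow> carrier H"
    and rel: "\<And>l r. (l, r) \<in> R \<Longrightarrow> l \<in> words I \<Longrightarrow> r \<in> words I \<Longrightarrow> word_val H f l = word_val H f r"
  shows "\<exists>\<phi>\<in>hom G H. \<forall>i\<in>I. \<phi> (x i) = f i"
proof -
  interpret G: group G by fact
  interpret H: group H by fact
  define \<phi> where "\<phi> g = word_val H f (SOME w. w \<in> words I \<and> word_val G x w = g)" for g
  have x: "x \<in> I \<rightarrow> carrier G" and surj: "word_val G x ` words I = carrier G"
    and eq: "\<And>v w. v \<in> words I \<Longrightarrow> w \<in> words I \<Longrightarrow>
      word_val G x v = word_val G x w \<longleftrightarrow> pres_eq I R v w"
    using assms(3) by (auto simp: has_presentation_def)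
  have val: "\<phi> (word_val G x w) = word_val H f w" if w: "w \<in> words I" for w
  proof -
    let ?v = "SOME v. v \<in> words I \<and> word_val G x v = word_val G x w"
    have "?v \<in> words I \<and> word_val G x ?v = word_val G x w"
      by (rule someI[of _ w]) (use w in auto)
    then show ?thesis
      unfolding \<phi>_def using eq w H.pres_eq_word_val[OF assms(4) rel] by blast
  qed
  show ?thesis
  proof (intro bexI ballI)
    show "\<phi> \<in> hom G H"
    proof (rule homI)
      fix g h assume "g \<in> carrier G" "h \<in> carrier G"
      then obtain v w where *: "v \<in> words I" "w \<in> words I" "g = word_val G x v" "h = word_val G x w"
        using surj by blast
      show "\<phi> g \<in> carrier H" using * by (simp add: val H.word_val_closed[OF assms(4)])
      have "g \<otimes>\<^bsub>G\<^esub> h = word_val G x (v @ w)" using * x by (simp add: G.word_val_append)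
      then have "\<phi> (g \<otimes>\<^bsub>G\<^esub> h) = word_val H f (v @ w)" using * val by simp
      also have "\<dots> = \<phi> g \<otimes>\<^bsub>H\<^esub> \<phi> h" using * assms(4) by (simp add: H.word_val_append val)
      finally show "\<phi> (g \<otimes>\<^bsub>G\<^esub> h) = \<phi> g \<otimes>\<^bsub>H\<^esub> \<phi> h" .
    qed
  next
    fix i assume "i \<in> I"
    then show "\<phi> (x i) = f i" using val[of "[(True, i)]"] x assms(4) by (auto simp: Pi_iff)
  qed
qed

lemma has_presentation_hom_eqI:
  assumes "group G" "group H" "has_presentation G I x R" "\<phi> \<in> hom G H" "\<psi> \<in> hom G H"
    and "\<And>i. i \<in> I \<Longrightarrow> \<phi> (x i) = \<psi> (x i)" "g \<in> carrier G"
  shows "\<phi> g = \<psi> g"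
proof -
  have x: "x \<in> I \<rightarrow> carrier G" and "g \<in> word_val G x ` words I"
    using assms by (auto simp: has_presentation_def)
  then obtain w where w: "w \<in> words I" "g = word_val G x w" by blast
  have "word_val H (\<phi> \<circ> x) w = word_val H (\<psi> \<circ> x) w"
    using w(1) assms(6) by (induction w) auto
  then show ?thesis using w x group.hom_word_val assms by metis
qed

lemma presented_group_has_presentation:
  "has_presentation (presented_group X R) X (\<lambda>a. word_class X R [(True, a)]) R"
  unfolding has_presentation_def
  by (auto simp: carrier_presented word_class_eq_word_val[symmetric] word_class_eq_iff)

section \<open>Fundamental groups\<close>

lemma loop_class_eqI: "homotopic_paths U f g \<Longrightarrow> loop_class U f = loop_class U g"
  unfolding loop_class_def by (auto intro: homotopic_paths_trans homotopic_paths_sym)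

lemma loop_class_self: "path f \<Longrightarrow> path_image f \<subseteq> U \<Longrightarrow> f \<in> loop_class U f"
  by (simp add: loop_class_def)

lemma fundamental_group_mult:
  assumes f: "path f" "path_image f \<subseteq> U" and g: "path g" "path_image g \<subseteq> U"
    and "pathfinish f = pathstart g"
  shows "loop_class U f \<otimes>\<^bsub>fundamental_group U p\<^esub> loop_class U g = loop_class U (f +++ g)"
proof -
  have eq: "loop_class U (f' +++ g') = loop_class U (f +++ g)"
    if "f' \<in> loop_class U f" "g' \<in> loop_class U g" for f' g'
    using that assms(5) by (intro loop_class_eqI[symmetric] homotopic_paths_join) (auto simp: loop_class_def)
  have "(\<Union>f'\<in>loop_class U f. \<Union>g'\<in>loop_class U g. loop_class U (f' +++ g')) =
      (\<Union>f'\<in>loop_class U f. \<Union>g'\<in>loop_class U g. loop_class U (f +++ g))"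
    by (intro SUP_cong HOL.refl eq)
  also have "\<dots> = loop_class U (f +++ g)"
    using loop_class_self[OF f] loop_class_self[OF g] by auto
  finally show ?thesis by (simp add: fundamental_group_def)
qed

lemma fundamental_group_is_group:
  fixes U :: "'a::real_normed_vector set"
  assumes p: "p \<in> U"
  shows "group (fundamental_group U p)"
proof -
  let ?G = "fundamental_group U p"
  define loops where "loops = {f. path f \<and> path_image f \<subseteq> U \<and> pathstart f = p \<and> pathfinish f = p}"
  have carrier: "carrier ?G = loop_class U ` loops"
    by (simp add: fundamental_group_def loops_def)
  \<comment> \<open>The constant loop is written as a degenerate segment, the form in which the
    homotopy laws for units and inverses are stated.\<close>
  have one: "\<one>\<^bsub>?G\<^esub> = loop_class U (linepath p p)"
    by (simp add: fundamental_group_def linepath_refl)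
  have const: "linepath p p \<in> loops" using p by (simp add: loops_def)
  have join: "f +++ g \<in> loops" if "f \<in> loops" "g \<in> loops" for f g
    using that by (simp add: loops_def subset_path_image_join)
  have mult: "loop_class U f \<otimes>\<^bsub>?G\<^esub> loop_class U g = loop_class U (f +++ g)"
    if "f \<in> loops" "g \<in> loops" for f g
    using that by (intro fundamental_group_mult) (simp_all add: loops_def)
  show ?thesis
  proof (rule groupI)
    fix A B assume "A \<in> carrier ?G" "B \<in> carrier ?G"
    then show "A \<otimes>\<^bsub>?G\<^esub> B \<in> carrier ?G" by (auto simp: carrier mult join)
  next
    show "\<one>\<^bsub>?G\<^esub> \<in> carrier ?G" using const by (simp add: carrier one)
  next
    fix A B C assume "A \<in> carrier ?G" "B \<in> carrier ?G" "C \<in> carrier ?G"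
    then obtain f g h where *: "f \<in> loops" "g \<in> loops" "h \<in> loops"
      "A = loop_class U f" "B = loop_class U g" "C = loop_class U h"
      by (auto simp: carrier)
    have "homotopic_paths U (f +++ (g +++ h)) ((f +++ g) +++ h)"
      using *(1-3) by (intro homotopic_paths_assoc) (simp_all add: loops_def)
    then show "A \<otimes>\<^bsub>?G\<^esub> B \<otimes>\<^bsub>?G\<^esub> C = A \<otimes>\<^bsub>?G\<^esub> (B \<otimes>\<^bsub>?G\<^esub> C)"
      using * by (simp add: mult join loop_class_eqI)
  next
    fix A assume "A \<in> carrier ?G"
    then obtain f where f: "f \<in> loops" "A = loop_class U f" by (auto simp: carrier)
    have "homotopic_paths U (linepath p p +++ f) f"
      using f(1) by (intro homotopic_paths_lid') (simp_all add: loops_def)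
    then show "\<one>\<^bsub>?G\<^esub> \<otimes>\<^bsub>?G\<^esub> A = A"
      using f const by (simp add: one mult loop_class_eqI)
    have r: "reversepath f \<in> loops" using f(1) by (simp add: loops_def)
    have "homotopic_paths U (reversepath f +++ f) (linepath p p)"
      using homotopic_paths_linv[of f U] f(1) by (simp add: loops_def)
    then show "\<exists>B\<in>carrier ?G. B \<otimes>\<^bsub>?G\<^esub> A = \<one>\<^bsub>?G\<^esub>"
      using f r by (intro bexI[of _ "loop_class U (reversepath f)"])
        (simp_all add: one mult loop_class_eqI carrier)
  qed
qed

lemma fundamental_group_empty:
  assumes "p \<notin> U"
  shows "carrier (fundamental_group U p) = {}"
proof -
  have "p \<in> U" if "path_image f \<subseteq> U" "pathstart f = p" for f
    using that pathstart_in_path_image[of f] by blast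
  then have "{f. path f \<and> path_image f \<subseteq> U \<and> pathstart f = p \<and> pathfinish f = p} = {}"
    using assms by blast
  then show ?thesis unfolding fundamental_group_def by simp
qed

text \<open>The presentation itself places the base point in \<open>U\<close>: the empty word has a
  value in the carrier, so there is a loop at \<open>p\<close> inside \<open>U\<close>.\<close>

lemma has_presentation_fundamental_group:
  fixes U :: "'a::real_normed_vector set"
  assumes "has_presentation (fundamental_group U p) I x R"
  shows "group (fundamental_group U p)"
proof -
  have "[] \<in> words I" by (simp add: words_def)
  moreover have "carrier (fundamental_group U p) = word_val (fundamental_group U p) x ` words I"
    using assms by (simp add: has_presentation_def)
  ultimately have "carrier (fundamental_group U p) \<noteq> {}"
    by (metis empty_iff image_is_empty)
  then have "p \<in> U" by (rule contrapos_np) (rule fundamental_group_empty)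
  then show ?thesis by (rule fundamental_group_is_group)
qed

section \<open>Dilations\<close>

lemma GL_carrierD: "A \<in> carrier (GL N) \<Longrightarrow> A \<in> carrier_mat N N"
  by (simp add: GL_def)

lemma GL_simps: "A \<otimes>\<^bsub>GL N\<^esub> B = A * B" "\<one>\<^bsub>GL N\<^esub> = 1\<^sub>m N"
  by (simp_all add: GL_def)

text \<open>\<open>invertible_mat\<close> leaves the size of the inverse open; comparing the
  dimensions of both sides of the two product equations shows that it is \<open>N\<close> by
  \<open>N\<close>.\<close>

lemma GL_carrier_iff:
  "A \<in> carrier (GL N) \<longleftrightarrow>
    A \<in> carrier_mat N N \<and> (\<exists>B\<in>carrier_mat N N. A * B = 1\<^sub>m N \<and> B * A = 1\<^sub>m N)"
proof
  assume "A \<in> carrier (GL N)"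
  then have A: "A \<in> carrier_mat N N" and "invertible_mat A" by (auto simp: GL_def)
  then obtain B where B: "A * B = 1\<^sub>m (dim_row A)" "B * A = 1\<^sub>m (dim_row B)"
    by (auto simp: invertible_mat_def inverts_mat_def)
  have "dim_row B = N" using arg_cong[OF B(2), of dim_col] A by simp
  moreover have "dim_col B = N" using arg_cong[OF B(1), of dim_col] A by simp
  ultimately show "A \<in> carrier_mat N N \<and> (\<exists>B\<in>carrier_mat N N. A * B = 1\<^sub>m N \<and> B * A = 1\<^sub>m N)"
    using A B by auto
next
  assume "A \<in> carrier_mat N N \<and> (\<exists>B\<in>carrier_mat N N. A * B = 1\<^sub>m N \<and> B * A = 1\<^sub>m N)"
  then show "A \<in> carrier (GL N)"
    by (auto simp: GL_def invertible_mat_def inverts_mat_def square_mat.simps)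
qed

lemma GL_group: "group (GL N)"
proof (rule groupI)
  fix A B assume "A \<in> carrier (GL N)" "B \<in> carrier (GL N)"
  then obtain A' B' where *: "A \<in> carrier_mat N N" "B \<in> carrier_mat N N"
    "A' \<in> carrier_mat N N" "B' \<in> carrier_mat N N"
    "A * A' = 1\<^sub>m N" "A' * A = 1\<^sub>m N" "B * B' = 1\<^sub>m N" "B' * B = 1\<^sub>m N"
    by (auto simp: GL_carrier_iff)
  have "A * B * (B' * A') = A * (B * B') * A'"
    using *(1-4) by (simp add: assoc_mult_mat[of _ N N _ N _ N])
  moreover have "B' * A' * (A * B) = B' * (A' * A) * B"
    using *(1-4) by (simp add: assoc_mult_mat[of _ N N _ N _ N])
  ultimately have "A * B * (B' * A') = 1\<^sub>m N" "B' * A' * (A * B) = 1\<^sub>m N"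
    using * by (simp_all del: assoc_mult_mat)
  moreover have "A * B \<in> carrier_mat N N" "B' * A' \<in> carrier_mat N N" using * by simp_all
  ultimately show "A \<otimes>\<^bsub>GL N\<^esub> B \<in> carrier (GL N)"
    unfolding GL_carrier_iff GL_simps by (intro conjI bexI[of _ "B' * A'"])
next
  fix A assume "A \<in> carrier (GL N)"
  then obtain B where *: "A \<in> carrier_mat N N" "B \<in> carrier_mat N N" "A * B = 1\<^sub>m N" "B * A = 1\<^sub>m N"
    by (auto simp: GL_carrier_iff)
  then have "B \<in> carrier (GL N)" unfolding GL_carrier_iff by (intro conjI bexI[of _ A])
  then show "\<exists>B\<in>carrier (GL N). B \<otimes>\<^bsub>GL N\<^esub> A = \<one>\<^bsub>GL N\<^esub>"
    using *(4) by (intro bexI[of _ B]) (simp_all add: GL_simps)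
qed (auto simp: GL_carrier_iff GL_simps assoc_mult_mat[of _ N N _ N _ N])

lemma dilation_apply: "z \<in> carrier_vec N \<Longrightarrow> dilation N \<alpha> b z = \<alpha> \<cdot>\<^sub>v z + b"
  by (simp add: dilation_def)

lemma dilation_zero: "b \<in> carrier_vec N \<Longrightarrow> dilation N \<alpha> b (0\<^sub>v N) = b"
  by (auto simp: dilation_apply)

lemma dilation_closed:
  "\<alpha> \<noteq> 0 \<Longrightarrow> b \<in> carrier_vec N \<Longrightarrow> dilation N \<alpha> b \<in> carrier (dilation_group N)"
  by (auto simp: dilation_group_def)

text \<open>The left factor is applied first, so z goes to \<beta> (\<alpha> z + b) + c; hence the
  second ratio multiplies the first translation.\<close>

lemma dilation_mult:
  assumes "b \<in> carrier_vec N" "c \<in> carrier_vec N"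
  shows "dilation N \<alpha> b \<otimes>\<^bsub>dilation_group N\<^esub> dilation N \<beta> c = dilation N (\<alpha> * \<beta>) (\<beta> \<cdot>\<^sub>v b + c)"
proof (rule ext)
  fix z
  show "(dilation N \<alpha> b \<otimes>\<^bsub>dilation_group N\<^esub> dilation N \<beta> c) z = dilation N (\<alpha> * \<beta>) (\<beta> \<cdot>\<^sub>v b + c) z"
  proof (cases "z \<in> carrier_vec N")
    case True
    then show ?thesis using assms
      by (auto simp: dilation_group_def compose_def dilation_apply algebra_simps
          intro!: eq_vecI)
  next
    case False
    then show ?thesis by (simp add: dilation_group_def compose_def dilation_def)
  qed
qed

lemma dilation_one: "\<one>\<^bsub>dilation_group N\<^esub> = dilation N 1 (0\<^sub>v N)"
  by (auto simp: dilation_group_def dilation_def)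

text \<open>The origin shows the translation, and the first coordinate of the image of a unit vector
  then shows the ratio. In dimension 0 there is no such vector and the ratio would be
  invisible.\<close>

lemma dilation_eqD:
  assumes "N \<ge> 1" "b \<in> carrier_vec N" "c \<in> carrier_vec N" "dilation N \<alpha> b = dilation N \<beta> c"
  shows "\<alpha> = \<beta>" "b = c"
proof -
  show "b = c" using assms(2-4) dilation_zero by metis
  have "(dilation N \<alpha> b (unit_vec N 0)) $ 0 = (dilation N \<beta> c (unit_vec N 0)) $ 0"
    using assms(4) by simp
  then show "\<alpha> = \<beta>" using assms(1-3) \<open>b = c\<close> by (simp add: dilation_apply)
qed

lemma dilation_group_is_group: "group (dilation_group N)"
proof (rule groupI)
  have [simp]: "a \<cdot>\<^sub>v (b + c) = a \<cdot>\<^sub>v b + a \<cdot>\<^sub>v c"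
    if "b \<in> carrier_vec N" "c \<in> carrier_vec N" for a :: complex and b c
    using that by (rule smult_add_distrib_vec)
  show "d \<otimes>\<^bsub>dilation_group N\<^esub> d' \<in> carrier (dilation_group N)"
    if d: "d \<in> carrier (dilation_group N)" "d' \<in> carrier (dilation_group N)" for d d'
  proof -
    obtain \<alpha> b \<beta> c where *: "d = dilation N \<alpha> b" "\<alpha> \<noteq> 0" "b \<in> carrier_vec N"
      "d' = dilation N \<beta> c" "\<beta> \<noteq> 0" "c \<in> carrier_vec N"
      using d by (auto simp: dilation_group_def)
    then show ?thesis by (simp add: dilation_mult dilation_closed)
  qed
  show "\<one>\<^bsub>dilation_group N\<^esub> \<in> carrier (dilation_group N)"
    by (simp add: dilation_one dilation_closed)
  show "d \<otimes>\<^bsub>dilation_group N\<^esub> d' \<otimes>\<^bsub>dilation_group N\<^esub> d'' =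
      d \<otimes>\<^bsub>dilation_group N\<^esub> (d' \<otimes>\<^bsub>dilation_group N\<^esub> d'')"
    if d: "d \<in> carrier (dilation_group N)" "d' \<in> carrier (dilation_group N)"
      "d'' \<in> carrier (dilation_group N)" for d d' d''
  proof -
    obtain \<alpha> b \<beta> c \<gamma> e where *: "d = dilation N \<alpha> b" "b \<in> carrier_vec N"
      "d' = dilation N \<beta> c" "c \<in> carrier_vec N" "d'' = dilation N \<gamma> e" "e \<in> carrier_vec N"
      using d by (auto simp: dilation_group_def)
    have "\<gamma> \<cdot>\<^sub>v (\<beta> \<cdot>\<^sub>v b + c) + e = (\<beta> * \<gamma>) \<cdot>\<^sub>v b + (\<gamma> \<cdot>\<^sub>v c + e)"
      using * by (intro eq_vecI) (auto simp: algebra_simps)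
    then show ?thesis using * by (simp add: dilation_mult mult.assoc)
  qed
  show "\<one>\<^bsub>dilation_group N\<^esub> \<otimes>\<^bsub>dilation_group N\<^esub> d = d"
    if d: "d \<in> carrier (dilation_group N)" for d
  proof -
    obtain \<alpha> b where *: "d = dilation N \<alpha> b" "b \<in> carrier_vec N"
      using d by (auto simp: dilation_group_def)
    have "\<alpha> \<cdot>\<^sub>v 0\<^sub>v N + b = b" using * by auto
    then show ?thesis using * by (simp add: dilation_one dilation_mult)
  qed
  show "\<exists>d'\<in>carrier (dilation_group N). d' \<otimes>\<^bsub>dilation_group N\<^esub> d = \<one>\<^bsub>dilation_group N\<^esub>"
    if d: "d \<in> carrier (dilation_group N)" for d
  proof -
    obtain \<alpha> b where *: "d = dilation N \<alpha> b" "\<alpha> \<noteq> 0" "b \<in> carrier_vec N"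
      using d by (auto simp: dilation_group_def)
    have "\<alpha> \<cdot>\<^sub>v ((- inverse \<alpha>) \<cdot>\<^sub>v b) + b = 0\<^sub>v N"
      using * by (intro eq_vecI) auto
    then show ?thesis
      using * by (intro bexI[of _ "dilation N (inverse \<alpha>) ((- inverse \<alpha>) \<cdot>\<^sub>v b)"])
        (simp_all add: dilation_mult dilation_one dilation_closed)
  qed
qed

lemma dilation_act_dilation:
  assumes "A \<in> carrier_mat N N" "b \<in> carrier_vec N"
  shows "dilation_act N A (dilation N \<alpha> b) = dilation N \<alpha> (A *\<^sub>v b)"
proof -
  have "\<alpha> \<cdot>\<^sub>v z + b - b + A *\<^sub>v b = \<alpha> \<cdot>\<^sub>v z + A *\<^sub>v b" if "z \<in> carrier_vec N" for z
    using that assms by (intro eq_vecI) auto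
  then have "(\<lambda>z\<in>carrier_vec N. dilation N \<alpha> b z - b + A *\<^sub>v b) = dilation N \<alpha> (A *\<^sub>v b)"
    unfolding dilation_def[of N \<alpha> "A *\<^sub>v b"] by (intro restrict_ext) (simp add: dilation_apply)
  then show ?thesis using assms(2) by (simp add: dilation_act_def dilation_zero)
qed

text \<open>Needed so that equivariance of a representation becomes an equality of two
  homomorphisms, which can be tested on generators.\<close>

lemma dilation_act_hom:
  assumes A: "A \<in> carrier_mat N N"
  shows "dilation_act N A \<in> hom (dilation_group N) (dilation_group N)"
proof (rule homI)
  fix d assume "d \<in> carrier (dilation_group N)"
  then obtain \<alpha> b where *: "d = dilation N \<alpha> b" "\<alpha> \<noteq> 0" "b \<in> carrier_vec N"
    by (auto simp: dilation_group_def)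
  then show "dilation_act N A d \<in> carrier (dilation_group N)"
    using A by (simp add: dilation_act_dilation dilation_closed)
next
  fix d d' assume "d \<in> carrier (dilation_group N)" "d' \<in> carrier (dilation_group N)"
  then obtain \<alpha> b \<beta> c where *: "d = dilation N \<alpha> b" "b \<in> carrier_vec N"
    "d' = dilation N \<beta> c" "c \<in> carrier_vec N"
    by (auto simp: dilation_group_def)
  have "A *\<^sub>v (\<beta> \<cdot>\<^sub>v b + c) = \<beta> \<cdot>\<^sub>v (A *\<^sub>v b) + A *\<^sub>v c"
    using A * by (simp add: mult_add_distrib_mat_vec[of _ N N] mult_mat_vec[of _ N N])
  then show "dilation_act N A (d \<otimes>\<^bsub>dilation_group N\<^esub> d') =
      dilation_act N A d \<otimes>\<^bsub>dilation_group N\<^esub> dilation_act N A d'"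
    using A * by (simp add: dilation_mult dilation_act_dilation)
qed

text \<open>Triples \<open>(\<alpha>, A, b)\<close> multiply the way the ratio, the matrix and the translation part of
  \<open>\<^sup>eg\<close> do under an \<open>S\<close>-group representation.\<close>

definition twisted_dilations :: "nat \<Rightarrow> (complex \<times> complex mat \<times> complex vec) monoid" where
  "twisted_dilations N =
     \<lparr>carrier = {(\<alpha>, A, b). \<alpha> \<noteq> 0 \<and> A \<in> carrier (GL N) \<and> b \<in> carrier_vec N},
      mult = (\<lambda>(\<alpha>, A, b) (\<beta>, B, c). (\<alpha> * \<beta>, A * B, \<beta> \<cdot>\<^sub>v b + A *\<^sub>v c)),
      one = (1, 1\<^sub>m N, 0\<^sub>v N)\<rparr>"

lemma twisted_dilations_simps [simp]:
  "(\<alpha>, A, b) \<in> carrier (twisted_dilations N) \<longleftrightarrow>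
    \<alpha> \<noteq> 0 \<and> A \<in> carrier (GL N) \<and> b \<in> carrier_vec N"
  "(\<alpha>, A, b) \<otimes>\<^bsub>twisted_dilations N\<^esub> (\<beta>, B, c) = (\<alpha> * \<beta>, A * B, \<beta> \<cdot>\<^sub>v b + A *\<^sub>v c)"
  "\<one>\<^bsub>twisted_dilations N\<^esub> = (1, 1\<^sub>m N, 0\<^sub>v N)"
  by (auto simp: twisted_dilations_def)

text \<open>The triple can be read as the block upper triangular matrix with diagonal blocks
  \<open>A\<close> and \<open>\<alpha>\<close> and upper right column \<open>b\<close>; the product
  of triples is then the matrix product.\<close>

lemma twisted_dilations_group: "group (twisted_dilations N)"
proof -
  interpret GL: group "GL N" by (rule GL_group)
  show ?thesis
  proof (rule groupI)
    fix d d' assume "d \<in> carrier (twisted_dilations N)" "d' \<in> carrier (twisted_dilations N)"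
    then show "d \<otimes>\<^bsub>twisted_dilations N\<^esub> d' \<in> carrier (twisted_dilations N)"
      using GL.m_closed
      by (cases d; cases d') (auto simp: GL_simps intro!: add_carrier_vec mult_mat_vec_carrier[OF GL_carrierD])
  next
    show "\<one>\<^bsub>twisted_dilations N\<^esub> \<in> carrier (twisted_dilations N)"
      using GL.one_closed by (simp add: GL_simps)
  next
    fix d d' d''
    assume "d \<in> carrier (twisted_dilations N)" "d' \<in> carrier (twisted_dilations N)"
      "d'' \<in> carrier (twisted_dilations N)"
    moreover obtain \<alpha> A b \<beta> B c \<gamma> C e where [simp]: "d = (\<alpha>, A, b)" "d' = (\<beta>, B, c)" "d'' = (\<gamma>, C, e)"
      by (cases d, cases d', cases d'') blast
    ultimately have *: "A \<in> carrier_mat N N" "B \<in> carrier_mat N N" "C \<in> carrier_mat N N"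
      "b \<in> carrier_vec N" "c \<in> carrier_vec N" "e \<in> carrier_vec N"
      by (auto dest: GL_carrierD)
    have "\<gamma> \<cdot>\<^sub>v (\<beta> \<cdot>\<^sub>v b + A *\<^sub>v c) + A * B *\<^sub>v e = (\<beta> * \<gamma>) \<cdot>\<^sub>v b + (\<gamma> \<cdot>\<^sub>v (A *\<^sub>v c) + A *\<^sub>v (B *\<^sub>v e))"
      using * assoc_mult_mat_vec[of A N N B N e]
      by (intro eq_vecI) (auto simp: algebra_simps)
    also have "\<dots> = (\<beta> * \<gamma>) \<cdot>\<^sub>v b + A *\<^sub>v (\<gamma> \<cdot>\<^sub>v c + B *\<^sub>v e)"
      using * by (simp add: mult_add_distrib_mat_vec[of _ N N] mult_mat_vec[of _ N N])
    finally show "d \<otimes>\<^bsub>twisted_dilations N\<^esub> d' \<otimes>\<^bsub>twisted_dilations N\<^esub> d'' =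
        d \<otimes>\<^bsub>twisted_dilations N\<^esub> (d' \<otimes>\<^bsub>twisted_dilations N\<^esub> d'')"
      using * by (simp add: assoc_mult_mat[of _ N N _ N _ N] mult.assoc)
  next
    fix d assume d: "d \<in> carrier (twisted_dilations N)"
    obtain \<alpha> A b where [simp]: "d = (\<alpha>, A, b)" by (cases d) blast
    have *: "\<alpha> \<noteq> 0" "A \<in> carrier (GL N)" "A \<in> carrier_mat N N" "b \<in> carrier_vec N"
      using d by (auto dest: GL_carrierD)
    have "\<alpha> \<cdot>\<^sub>v 0\<^sub>v N + b = b" using * by auto
    then show "\<one>\<^bsub>twisted_dilations N\<^esub> \<otimes>\<^bsub>twisted_dilations N\<^esub> d = d" using * by simp
    obtain B where B: "B \<in> carrier (GL N)" "B * A = 1\<^sub>m N"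
      using *(2) GL.l_inv_ex by (auto simp: GL_simps)
    have Bc: "B \<in> carrier_mat N N" using B by (simp add: GL_carrierD)
    \<comment> \<open>The translation part of a left inverse has to solve \<alpha> y + B b = 0,
      where B is the inverse of A; this dictates the witness.\<close>
    then have "\<alpha> \<cdot>\<^sub>v ((- inverse \<alpha>) \<cdot>\<^sub>v (B *\<^sub>v b)) + B *\<^sub>v b = 0\<^sub>v N"
      using * by (intro eq_vecI) auto
    then show "\<exists>d'\<in>carrier (twisted_dilations N).
        d' \<otimes>\<^bsub>twisted_dilations N\<^esub> d = \<one>\<^bsub>twisted_dilations N\<^esub>"
      using * B Bc
      by (intro bexI[of _ "(inverse \<alpha>, B, (- inverse \<alpha>) \<cdot>\<^sub>v (B *\<^sub>v b))"]) auto
  qed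
qed

section \<open>Evaluation of Laurent polynomials\<close>

lemma laurent_eval_superset:
  assumes "finite S" "Poly_Mapping.keys f \<subseteq> S"
  shows "laurent_eval f a = (\<Sum>m\<in>S. Poly_Mapping.lookup f m * a powi m)"
  unfolding laurent_eval_def using assms
  by (intro sum.mono_neutral_left) (auto simp: in_keys_iff)

lemma laurent_eval_single [simp]: "laurent_eval (Poly_Mapping.single m c) a = c * a powi m"
  by (subst laurent_eval_superset[of "{m}"]) auto

lemma laurent_eval_add: "laurent_eval (f + g) a = laurent_eval f a + laurent_eval g a"
proof -
  let ?S = "Poly_Mapping.keys f \<union> Poly_Mapping.keys g"
  have "laurent_eval h a = (\<Sum>m\<in>?S. Poly_Mapping.lookup h m * a powi m)" if "h \<in> {f, g, f + g}" for h
    using that keys_add[of f g] by (intro laurent_eval_superset) auto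
  then show ?thesis by (simp add: lookup_add distrib_right sum.distrib)
qed

lemma laurent_eval_zero [simp]: "laurent_eval 0 a = 0"
  by (simp add: laurent_eval_def)

lemma laurent_eval_sum: "laurent_eval (sum F S) a = (\<Sum>s\<in>S. laurent_eval (F s) a)"
  by (induction S rule: infinite_finite_induct) (simp_all add: laurent_eval_add)

lemma laurent_sum_singles:
  "f = (\<Sum>m\<in>Poly_Mapping.keys f. Poly_Mapping.single m (Poly_Mapping.lookup f m))"
  by (rule poly_mapping_eqI)
    (auto simp: lookup_sum lookup_single when_def in_keys_iff)

text \<open>Exponents may be negative, so additivity of \<open>powi\<close> in the exponent is
  needed, and this breaks down at 0: the product of t and its inverse is 1, while t takes the value
  0 there.\<close>

lemma laurent_eval_mult:
  assumes "a \<noteq> 0"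
  shows "laurent_eval (f * g) a = laurent_eval f a * laurent_eval g a"
proof -
  have "f * g = (\<Sum>m\<in>Poly_Mapping.keys f. \<Sum>k\<in>Poly_Mapping.keys g.
      Poly_Mapping.single (m + k) (Poly_Mapping.lookup f m * Poly_Mapping.lookup g k))"
    by (subst (1) laurent_sum_singles[of f], subst (1) laurent_sum_singles[of g])
      (simp add: sum_product mult_single)
  then show ?thesis
    using assms by (simp add: laurent_eval_sum laurent_eval_def[of f] laurent_eval_def[of g] sum_product power_int_add mult_ac)
qed

lemma laurent_eval_hom:
  assumes "a \<noteq> 0"
  shows "comm_ring_hom (\<lambda>f. laurent_eval f a)"
proof
  show "laurent_eval 1 a = 1"
    using laurent_eval_single[of 0 1 a] by (simp del: laurent_eval_single)
qed (simp_all add: laurent_eval_add laurent_eval_mult assms)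

lemma diff_dvd_power_diff: "(x - y) dvd (x ^ n - y ^ n)" for x y :: "'a::comm_ring_1"
  by (metis dvd_triv_left power_diff_sumr2)

text \<open>If f is the sum of the c_m t^m and f(a) = 0, then f is also the sum of the c_m (t^m -
  a^m), and each difference is divisible by t - a.\<close>

lemma laurent_factor_theorem:
  assumes a: "a \<noteq> 0"
  shows "laurent_t - laurent_const a dvd f \<longleftrightarrow> laurent_eval f a = 0"
proof
  interpret comm_ring_hom "\<lambda>f. laurent_eval f a" by (rule laurent_eval_hom[OF a])
  assume "laurent_t - laurent_const a dvd f"
  then show "laurent_eval f a = 0"
    by (auto simp: laurent_t_def laurent_const_def hom_mult hom_minus)
next
  let ?p = "laurent_t - laurent_const a"
  have pow_t: "laurent_t ^ n = Poly_Mapping.single (int n) 1" for n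
    by (induction n) (simp_all add: laurent_t_def mult_single)
  have pow_a: "laurent_const c ^ n = laurent_const (c ^ n)" for c n
    by (induction n) (simp_all add: laurent_const_def mult_single)
  have pos: "?p dvd Poly_Mapping.single (int n) 1 - laurent_const (a ^ n)" for n
    using diff_dvd_power_diff[of laurent_t "laurent_const a" n] by (simp add: pow_t pow_a)
  have mono: "?p dvd Poly_Mapping.single m 1 - laurent_const (a powi m)" for m
  proof (cases m rule: int_cases2)
    case (nonneg n)
    then show ?thesis using pos[of n] by simp
  next
    case (nonpos n)
    \<comment> \<open>Negative exponents reduce to positive ones, as t^-n - a^-n is the multiple of
      t^n - a^n by -a^-n t^-n.\<close>
    have "Poly_Mapping.single m 1 - laurent_const (a powi m) =
      (Poly_Mapping.single (int n) 1 - laurent_const (a ^ n)) * - Poly_Mapping.single (- int n) (a powi m)"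
      using a nonpos
      by (simp add: laurent_const_def left_diff_distrib mult_single power_int_minus)
    then show ?thesis using pos[of n] by (metis dvd_mult2)
  qed
  assume zero: "laurent_eval f a = 0"
  let ?c = "Poly_Mapping.lookup f" and ?S = "Poly_Mapping.keys f"
  have "(\<Sum>m\<in>?S. laurent_const (?c m) * laurent_const (a powi m)) = laurent_const (laurent_eval f a)"
    by (intro poly_mapping_eqI)
      (simp add: laurent_eval_def laurent_const_def mult_single lookup_sum lookup_single when_def)
  moreover have "(\<Sum>m\<in>?S. laurent_const (?c m) * Poly_Mapping.single m 1) = f"
    using laurent_sum_singles[of f] by (simp add: laurent_const_def mult_single)
  ultimately have "f = (\<Sum>m\<in>?S. laurent_const (?c m) *
      (Poly_Mapping.single m 1 - laurent_const (a powi m)))"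
    by (simp add: right_diff_distrib sum_subtractf zero laurent_const_def)
  also have "?p dvd \<dots>" by (intro dvd_sum dvd_mult mono)
  finally show "?p dvd f" .
qed

text \<open>Vanishing at \<open>a\<close> is divisibility by t - a, and a common divisor of
  \<open>A\<close> is the same thing as a divisor of \<open>d\<close>.\<close>

lemma gcd_laurent_eval_eq_0_iff:
  assumes "a \<noteq> 0" "is_gcd_of d A"
  shows "laurent_eval d a = 0 \<longleftrightarrow> (\<forall>f\<in>A. laurent_eval f a = 0)"
  using assms unfolding is_gcd_of_def laurent_factor_theorem[OF assms(1), symmetric]
  by (meson dvd_trans)

text \<open>The factor t - a of \<open>f\<close> is not a unit, since 1 does not vanish at
  \<open>a\<close>; by irreducibility the cofactor is a unit and \<open>f\<close> is associated to t
  - a. Thus an irreducible factor missing from a polynomial certifies that the polynomial is nonzero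
  at \<open>a\<close>.\<close>

lemma irreducible_laurent_dvd_iff:
  assumes a: "a \<noteq> 0" and f: "irreducible f" "laurent_eval f a = 0"
  shows "f dvd g \<longleftrightarrow> laurent_eval g a = 0"
proof -
  interpret comm_ring_hom "\<lambda>f. laurent_eval f a" by (rule laurent_eval_hom[OF a])
  let ?p = "laurent_t - laurent_const a"
  have p0: "laurent_eval ?p a = 0"
    using laurent_factor_theorem[OF a, of ?p] by simp
  obtain h where h: "f = ?p * h" using f laurent_factor_theorem[OF a, of f] by (auto elim: dvdE)
  have "\<not> ?p dvd 1"
  proof
    assume "?p dvd 1"
    then have "laurent_eval 1 a = 0" using laurent_factor_theorem[OF a, of 1] by simp
    then show False by simp
  qed
  then have "h dvd 1" using f(1) h by (auto dest: irreducibleD)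
  then have "f dvd ?p" using h by (auto elim!: dvdE simp: mult.assoc)
  moreover have "?p dvd f" using h by simp
  ultimately show ?thesis
    unfolding laurent_factor_theorem[OF a, symmetric] by (meson dvd_trans)
qed

lemma minors_hom:
  assumes "comm_ring_hom h"
  shows "minors s (map_mat h M) = h ` minors s M"
proof -
  interpret comm_ring_hom h by fact
  have "submatrix (map_mat h M) I J = map_mat h (submatrix M I J)" for I J
    by (intro eq_matI) (simp_all add: submatrix_def pick_le)
  then have *: "Determinant.det (submatrix (map_mat h M) I J) = h (Determinant.det (submatrix M I J))" for I J
    by simp
  show ?thesis unfolding minors_def * by auto
qed

section \<open>Nullity and minors\<close>

text \<open>Rank-nullity for the linear map \<open>?T\<close>, whose image is the column space. The
  kernel is a space with replaced carrier because this is the shape of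
  \<open>linear_dim\<close>.\<close>

lemma rank_nullity_mat:
  fixes A :: "'a::field mat"
  assumes A: "A \<in> carrier_mat nr nc"
  shows "vec_space.rank nr A
    + vectorspace.dim class_ring ((module_vec TYPE('a) nc)\<lparr>carrier := mat_kernel A\<rparr>) = nc"
    and "subspace class_ring (mat_kernel A) (module_vec TYPE('a) nc)"
proof -
  interpret NC: vec_space "TYPE('a)" nc .
  interpret NR: vec_space "TYPE('a)" nr .
  let ?T = "\<lambda>v. A *\<^sub>v v"
  have hom: "?T \<in> module_hom class_ring NC.V NR.V"
    using A by (auto simp: module_hom_def mult_add_distrib_mat_vec module_vec_simps)
  interpret T: linear_map class_ring NC.V NR.V ?T
    by (intro linear_map.intro mod_hom.intro mod_hom_axioms.intro hom
        NC.vectorspace_axioms NR.vectorspace_axioms NC.module_axioms NR.module_axioms)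
  have ker: "T.kerT = mat_kernel A"
    using A by (auto simp: T.ker_def mat_kernel module_vec_simps)
  have im: "T.imT = NR.span (set (cols A))"
  proof -
    have "T.imT = ?T ` carrier_vec nc" by (simp add: T.im_def)
    also have "\<dots> = NR.col_space A"
      unfolding NR.col_space_eq[OF A] using A by (auto simp del: NR.lincomb_dim)
    finally show ?thesis by (simp only: NR.col_space_def)
  qed
  show "vec_space.rank nr A
    + vectorspace.dim class_ring ((module_vec TYPE('a) nc)\<lparr>carrier := mat_kernel A\<rparr>) = nc"
    using T.rank_nullity[OF NC.fin_dim] unfolding ker im NC.dim_is_n NR.rank_def by simp
  show "subspace class_ring (mat_kernel A) (module_vec TYPE('a) nc)"
    using T.kerT_is_subspace unfolding ker .
qed

lemma (in vec_space) rank_le_nr: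
  assumes "A \<in> carrier_mat n nc"
  shows "rank A \<le> n"
proof -
  have cols: "set (cols A) \<subseteq> carrier_vec n" using cols_dim assms by blast
  obtain S where S: "maximal S (\<lambda>T. T \<subseteq> set (cols A) \<and> lin_indpt T)"
    using maximal_exists_superset[of "set (cols A)" "\<lambda>T. T \<subseteq> set (cols A) \<and> lin_indpt T" "{}"]
      finite_lin_indpt2[of "{}"] by auto
  then have "S \<subseteq> carrier_vec n" "lin_indpt S" using cols by (auto simp: maximal_def)
  then show ?thesis
    using li_le_dim[OF fin_dim, of S] rank_card_indpt[OF assms S] by (simp add: dim_is_n)
qed

text \<open>A vector of \<open>T\<close> outside the span could be adjoined without losing
  independence, against maximality.\<close>

lemma (in vec_space) maximal_lin_indpt_spans:
  assumes "T \<subseteq> carrier_vec n" "maximal S (\<lambda>U. U \<subseteq> T \<and> lin_indpt U)"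
  shows "T \<subseteq> span S"
proof
  fix v assume v: "v \<in> T"
  have S: "S \<subseteq> T" "lin_indpt S" "S \<subseteq> carrier_vec n" using assms by (auto simp: maximal_def)
  show "v \<in> span S"
  proof (cases "v \<in> S")
    case True
    then show ?thesis using in_own_span[of S] S by auto
  next
    case False
    then have "\<not> (S \<union> {v} \<subseteq> T \<and> lin_indpt (S \<union> {v}))"
      using assms(2) unfolding maximal_def by blast
    then show ?thesis using lin_dep_iff_in_span[of S v] False S v assms(1) by auto
  qed
qed

text \<open>Being annihilated by \<open>w\<close> is a linear condition; this passes from selected
  rows of a matrix to all rows in their span.\<close>

lemma span_scalar_prod_zero:
  fixes w :: "'a::field vec"
  assumes S: "S \<subseteq> carrier_vec n" and w: "w \<in> carrier_vec n" and zero: "\<And>v. v \<in> S \<Longrightarrow> v \<bullet> w = 0"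
    and v: "v \<in> LinearCombinations.module.span class_ring (module_vec TYPE('a) n) S"
  shows "v \<bullet> w = 0"
proof -
  interpret V: vec_space "TYPE('a)" n .
  obtain a U where U: "finite U" "U \<subseteq> S" and v: "v = V.lincomb a U"
    using v unfolding V.span_def by auto
  have Uc: "U \<subseteq> carrier_vec n" using U S by auto
  have "v \<bullet> w = (\<Sum>i = 0..<n. (\<Sum>u\<in>U. a u * u $ i) * w $ i)"
    using w Uc by (simp add: scalar_prod_def v V.lincomb_index)
  also have "\<dots> = (\<Sum>u\<in>U. a u * (\<Sum>i = 0..<n. u $ i * w $ i))"
    by (simp add: sum_distrib_right sum_distrib_left mult.assoc) (rule sum.swap)
  also have "\<dots> = (\<Sum>u\<in>U. a u * (u \<bullet> w))"
    using w by (simp add: scalar_prod_def)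
  also have "\<dots> = 0" using zero U(2) by (intro sum.neutral) auto
  finally show ?thesis .
qed

lemma col_submatrix_UNIV:
  assumes "J \<subseteq> {..<dim_col A}" "j < card J"
  shows "col (submatrix A UNIV J) j = col A (pick J j)"
proof -
  have J: "{j. j < dim_col A \<and> j \<in> J} = J" using assms by auto
  have "pick J j < dim_col A" using assms pick_in_set_le[of j J] by auto
  then show ?thesis
    using assms(2) J by (intro eq_vecI) (simp_all add: dim_submatrix submatrix_index pick_UNIV)
qed

lemma submatrix_UNIV_carrier:
  shows "I \<subseteq> {..<dim_row A} \<Longrightarrow> submatrix A I UNIV \<in> carrier_mat (card I) (dim_col A)"
    and "J \<subseteq> {..<dim_col A} \<Longrightarrow> submatrix A UNIV J \<in> carrier_mat (dim_row A) (card J)"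
proof -
  have *: "{i. i < n \<and> i \<in> K} = K" if "K \<subseteq> {..<n}" for K and n :: nat using that by auto
  show "I \<subseteq> {..<dim_row A} \<Longrightarrow> submatrix A I UNIV \<in> carrier_mat (card I) (dim_col A)"
    using *[of I "dim_row A"] by (intro carrier_matI) (simp_all add: dim_submatrix)
  show "J \<subseteq> {..<dim_col A} \<Longrightarrow> submatrix A UNIV J \<in> carrier_mat (dim_row A) (card J)"
    using *[of J "dim_col A"] by (intro carrier_matI) (simp_all add: dim_submatrix)
qed

text \<open>Exactly \<open>k\<close> elements of \<open>I\<close> lie below \<open>pick I k\<close>,
  so \<open>k\<close> can be recovered from it; counting gives surjectivity.\<close>

lemma bij_betw_pick:
  assumes "finite I"
  shows "bij_betw (pick I) {..<card I} I"
proof -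
  have inj: "inj_on (pick I) {..<card I}"
    by (intro inj_onI) (metis card_pick_le lessThan_iff)
  have "pick I ` {..<card I} \<subseteq> I" using pick_in_set_le by auto
  then show ?thesis using inj assms
    by (simp add: bij_betw_def card_image card_subset_eq)
qed

text \<open>The rows are thinned out to a maximal independent set. It spans all rows, so the kernel
  stays trivial and rank-nullity forces at least \<open>s\<close> rows, while independence in
  dimension \<open>s\<close> allows at most \<open>s\<close>. A square matrix with trivial kernel
  has nonzero determinant.\<close>

lemma trivial_kernel_det_submatrix:
  fixes B :: "'a::field mat"
  assumes B: "B \<in> carrier_mat m s"
    and ker: "\<And>v. v \<in> carrier_vec s \<Longrightarrow> B *\<^sub>v v = 0\<^sub>v m \<Longrightarrow> v = 0\<^sub>v s"
  obtains I where "I \<subseteq> {..<m}" "card I = s" "det (submatrix B I UNIV) \<noteq> 0"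
proof -
  interpret V: vec_space "TYPE('a)" s .
  have rows: "set (rows B) \<subseteq> carrier_vec s" using B by (auto simp: rows_def)
  obtain S where S: "maximal S (\<lambda>T. T \<subseteq> set (rows B) \<and> V.lin_indpt T)"
    using maximal_exists_superset[of "set (rows B)" "\<lambda>T. T \<subseteq> set (rows B) \<and> V.lin_indpt T" "{}"]
      V.finite_lin_indpt2[of "{}"] by auto
  have span: "set (rows B) \<subseteq> V.span S" by (rule V.maximal_lin_indpt_spans[OF rows S])
  have S': "S \<subseteq> set (rows B)" "V.lin_indpt S" using S by (auto simp: maximal_def)
  then have "S \<subseteq> row B ` {..<m}" using B by (auto simp: rows_def)
  \<comment> \<open>Equal rows are one element of \<open>S\<close>, so \<open>I\<close> takes a
    single index for each; injectivity later gives \<open>card I = card S\<close>.\<close>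
  then obtain I where I: "I \<subseteq> {..<m}" "inj_on (row B) I" "S = row B ` I"
    by (meson subset_image_inj)
  let ?C = "submatrix B I UNIV"
  have C: "?C \<in> carrier_mat (card I) s" using submatrix_UNIV_carrier(1)[of I B] I B by auto
  have setI: "{i. i < dim_row B \<and> i \<in> I} = I" using I B by auto
  have Sc: "S \<subseteq> carrier_vec s" using S' rows by auto
  have kerC: "v = 0\<^sub>v s" if v: "v \<in> carrier_vec s" and Cv: "?C *\<^sub>v v = 0\<^sub>v (card I)" for v
  proof (rule ker[OF v], rule eq_vecI)
    have zero: "r \<bullet> v = 0" if "r \<in> S" for r
    proof -
      obtain i where i: "i \<in> I" "r = row B i" using \<open>r \<in> S\<close> I by auto
      have "finite I" using I(1) finite_subset by blast
      then have "i \<in> pick I ` {..<card I}"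
        using bij_betw_pick i(1) by (simp add: bij_betw_def)
      then obtain k where k: "k < card I" "i = pick I k" by blast
      have "row ?C k \<bullet> v = (?C *\<^sub>v v) $ k" using C k by auto
      moreover have "row ?C k = row B (pick I k)"
        using row_submatrix_UNIV[of k B I] setI k(1) by simp
      ultimately show ?thesis using k i Cv by simp
    qed
    show "dim_vec (B *\<^sub>v v) = dim_vec (0\<^sub>v m)" using B by auto
    fix i assume "i < dim_vec (0\<^sub>v m)"
    then have "i < m" by simp
    then have "row B i \<in> V.span S" using span B by (auto simp: rows_def)
    then have "row B i \<bullet> v = 0" by (intro span_scalar_prod_zero[OF Sc v zero])
    then show "(B *\<^sub>v v) $ i = 0\<^sub>v m $ i" using \<open>i < m\<close> B by auto
  qed
  then have "mat_kernel ?C = {0\<^sub>v s}" using C by (auto simp: mat_kernel)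
  \<comment> \<open>With the kernel zero, the rank of \<open>?C\<close> is \<open>s\<close>, and it
    cannot exceed the number of rows \<open>card I\<close>.\<close>
  then have "vec_space.rank (card I) ?C
      + vectorspace.dim class_ring ((module_vec TYPE('a) s)\<lparr>carrier := {0\<^sub>v s}\<rparr>) = s"
    using rank_nullity_mat(1)[OF C] by simp
  moreover have "vectorspace.dim class_ring ((module_vec TYPE('a) s)\<lparr>carrier := {0\<^sub>v s}\<rparr>) = 0"
    using V.dim_zero_vs V.span_empty by simp
  ultimately have "s \<le> card I" using vec_space.rank_le_nr[OF C] by simp
  moreover have "card I \<le> s"
    using V.li_le_dim(2)[OF V.fin_dim, of S] Sc S' I by (simp add: V.dim_is_n card_image)
  ultimately have "card I = s" by simp
  moreover have "det ?C \<noteq> 0"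
    using det_0_iff_vec_prod_zero_field[of ?C s] C \<open>card I = s\<close> kerC by auto
  ultimately show ?thesis using that I by blast
qed

text \<open>Choosing \<open>s\<close> independent columns gives a matrix with trivial kernel, and
  the rows of a nonzero minor are then found inside it.\<close>

lemma rank_ge_minor:
  fixes A :: "'a::field mat"
  assumes A: "A \<in> carrier_mat m c" and s: "s \<le> vec_space.rank m A"
  obtains I J where "I \<subseteq> {..<m}" "J \<subseteq> {..<c}" "card I = s" "card J = s" "det (submatrix A I J) \<noteq> 0"
proof -
  interpret V: vec_space "TYPE('a)" m .
  obtain S0 where S0: "maximal S0 (\<lambda>T. T \<subseteq> set (cols A) \<and> V.lin_indpt T)"
    using maximal_exists_superset[of "set (cols A)" "\<lambda>T. T \<subseteq> set (cols A) \<and> V.lin_indpt T" "{}"]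
      V.finite_lin_indpt2[of "{}"] by auto
  then have "V.rank A = card S0" by (rule V.rank_card_indpt[OF A])
  then obtain S where S: "S \<subseteq> S0" "card S = s" using s obtain_subset_with_card_n by metis
  have Sc: "S \<subseteq> set (cols A)" and li: "V.lin_indpt S"
    using S0 S V.subset_li_is_li[of S0 S] by (auto simp: maximal_def)
  have "S \<subseteq> col A ` {..<c}" using Sc A by (auto simp: cols_def)
  then obtain J where J: "J \<subseteq> {..<c}" "inj_on (col A) J" "S = col A ` J"
    by (meson subset_image_inj)
  have cardJ: "card J = s" using J S by (simp add: card_image)
  let ?B = "submatrix A UNIV J"
  have B: "?B \<in> carrier_mat m s" using submatrix_UNIV_carrier(2)[of J A] J A cardJ by auto
  have fJ: "finite J" using J finite_subset by blast
  have col: "col ?B j = col A (pick J j)" if "j < s" for j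
    using col_submatrix_UNIV[of J A j] J A cardJ that by auto
  have pick: "bij_betw (pick J) {..<s} J" using bij_betw_pick[OF fJ] cardJ by simp
  have "set (cols ?B) = (col A \<circ> pick J) ` {..<s}" using B col by (auto simp: cols_def)
  also have "\<dots> = S" using pick J(3) unfolding image_comp[symmetric] bij_betw_def by simp
  finally have setB: "set (cols ?B) = S" .
  \<comment> \<open>Independence concerns the set of columns; without repetitions it also excludes
    kernel vectors, which are relations on the list of columns.\<close>
  have "distinct (cols ?B)"
    using setB S B by (intro card_distinct) simp
  then have ker: "v = 0\<^sub>v s" if "v \<in> carrier_vec s" "?B *\<^sub>v v = 0\<^sub>v m" for v
    using V.lin_depI[OF B that(1) _ that(2)] setB li by auto
  obtain I where "I \<subseteq> {..<m}" "card I = s" "det (submatrix ?B I UNIV) \<noteq> 0"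
    using trivial_kernel_det_submatrix[OF B ker] by blast
  then show ?thesis using that[of I J] J cardJ submatrix_split[of A I J] by simp
qed

lemma minors_vanish_iff_rank:
  fixes A :: "'a::field mat"
  assumes A: "A \<in> carrier_mat m c"
  shows "(\<forall>d\<in>minors s A. d = 0) \<longleftrightarrow> vec_space.rank m A < s"
proof
  assume "vec_space.rank m A < s"
  moreover have "s \<le> vec_space.rank m A" if d: "d \<in> minors s A" "d \<noteq> 0" for d
  proof -
    obtain I J where "J \<subseteq> {..<c}" "card J = s" "det (submatrix A I J) \<noteq> 0"
      using d A by (auto simp: minors_def)
    moreover from this have "{j. j < c \<and> j \<in> J} = J" by auto
    ultimately show ?thesis using vec_space.rank_gt_minor[OF A, of I J] by simp
  qed
  ultimately show "\<forall>d\<in>minors s A. d = 0" by force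
next
  assume "\<forall>d\<in>minors s A. d = 0"
  then have *: "det (submatrix A I J) = 0"
    if "I \<subseteq> {..<m}" "J \<subseteq> {..<c}" "card I = s" "card J = s" for I J
    using that A unfolding minors_def by auto
  show "vec_space.rank m A < s"
  proof (rule ccontr)
    assume "\<not> vec_space.rank m A < s"
    then have "s \<le> vec_space.rank m A" by simp
    from rank_ge_minor[OF A this] * show False by metis
  qed
qed

text \<open>If \<open>w\<close> were outside the line spanned by \<open>v\<close>, the two would be
  independent in the kernel and its dimension would be at least 2. The factor is nonzero because
  \<open>w\<close> is.\<close>

lemma mat_kernel_proportional:
  fixes A :: "'a::field mat"
  assumes A: "A \<in> carrier_mat nr nc"
    and dim: "vectorspace.dim class_ring ((module_vec TYPE('a) nc)\<lparr>carrier := mat_kernel A\<rparr>) \<le> 1"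
    and v: "v \<in> mat_kernel A" "v \<noteq> 0\<^sub>v nc" and w: "w \<in> mat_kernel A" "w \<noteq> 0\<^sub>v nc"
  shows "\<exists>c. c \<noteq> 0 \<and> w = c \<cdot>\<^sub>v v"
proof -
  interpret kernel nr nc A by unfold_locales (rule A)
  have vc: "v \<in> carrier_vec nc" "w \<in> carrier_vec nc"
    using mat_kernel_carrier[OF A] v w by auto
  obtain B where B: "finite B" "basis B" using kernel_basis_exists[OF A] by blast
  have fd: "Ker.fin_dim" using B unfolding Ker.basis_def Ker.fin_dim_def by blast
  have empty: "NC.lin_indpt {}" by (auto simp: NC.lin_dep_def)
  have "v \<notin> NC.span {}" using v by (simp add: NC.span_empty)
  then have li: "NC.lin_indpt {v}"
    using NC.lin_dep_iff_in_span[of "{}" v] empty vc by simp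
  have "w \<in> NC.span {v}"
  proof (rule ccontr)
    assume not: "w \<notin> NC.span {v}"
    have "v \<in> NC.span {v}" using NC.in_own_span[of "{v}"] vc by auto
    then have ne: "w \<noteq> v" using not by auto
    then have "NC.lin_indpt ({v} \<union> {w})"
      using NC.lin_dep_iff_in_span[of "{v}" w] li vc not by simp
    \<comment> \<open>Independence passes from the ambient space to the kernel as a space of its
      own, where the dimension bound lives.\<close>
    then have "lin_indpt {v, w}"
      using lindep_same[of "{v, w}"] v w by (simp add: insert_commute)
    then have "card {v, w} \<le> dim" using Ker.li_le_dim(2)[OF fd, of "{v, w}"] v w by simp
    then show False using dim ne by simp
  qed
  then obtain a U where U: "finite U" "U \<subseteq> {v}" and wU: "w = NC.lincomb a U"
    unfolding NC.span_def by auto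
  have "w = (if v \<in> U then a v else 0) \<cdot>\<^sub>v v"
  proof (rule eq_vecI)
    fix i assume "i < dim_vec ((if v \<in> U then a v else 0) \<cdot>\<^sub>v v)"
    then have i: "i < nc" using vc by auto
    have "U \<subseteq> carrier_vec nc" using U vc by auto
    moreover have "U = {} \<or> U = {v}" using U by auto
    ultimately show "w $ i = ((if v \<in> U then a v else 0) \<cdot>\<^sub>v v) $ i"
      using vc i wU NC.lincomb_index[OF i, of U a] by auto
  qed (use vc in simp)
  moreover from this have "(if v \<in> U then a v else 0) \<noteq> 0" using w vc by auto
  ultimately show ?thesis by blast
qed

section \<open>The evaluated Alexander matrix\<close>

lemma sum_div_mod:
  fixes f :: "nat \<Rightarrow> nat \<Rightarrow> 'a::comm_monoid_add"
  assumes "N \<ge> 1"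
  shows "(\<Sum>w<n * N. f (w div N) (w mod N)) = (\<Sum>l<n. \<Sum>r<N. f l r)"
proof -
  have "(\<Sum>w<n * N. f (w div N) (w mod N)) = (\<Sum>l<n. \<Sum>w = l * N..<l * N + N. f (w div N) (w mod N))"
    by (simp add: sum.nat_group)
  also have "\<dots> = (\<Sum>l<n. \<Sum>r<N. f l r)"
  proof (rule sum.cong[OF HOL.refl])
    fix l
    have "(\<Sum>w = l * N..<l * N + N. f (w div N) (w mod N)) = (\<Sum>r = 0..<N. f ((r + l * N) div N) ((r + l * N) mod N))"
      using sum.shift_bounds_nat_ivl[of "\<lambda>w. f (w div N) (w mod N)" 0 "l * N" N] by (simp add: add.commute)
    also have "\<dots> = (\<Sum>r<N. f l r)"
      using assms by (intro sum.cong) auto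
    finally show "(\<Sum>w = l * N..<l * N + N. f (w div N) (w mod N)) = (\<Sum>r<N. f l r)" .
  qed
  finally show ?thesis .
qed

text \<open>Blocks are numbered from 1; the entry \<open>b 0\<close> does not occur.\<close>

definition blocks :: "nat \<Rightarrow> nat \<Rightarrow> (nat \<Rightarrow> 'a vec) \<Rightarrow> 'a vec" where
  "blocks N n b = Matrix.vec (n * N) (\<lambda>u. b (u div N + 1) $ (u mod N))"

lemma blocks_carrier [simp]: "blocks N n b \<in> carrier_vec (n * N)"
  by (simp add: blocks_def)

lemma block_index_less: "l < n \<Longrightarrow> r < N \<Longrightarrow> l * N + r < n * (N::nat)"
proof -
  assume "l < n" "r < N"
  then have "l * N + r < Suc l * N" by simp
  also have "\<dots> \<le> n * N" using \<open>l < n\<close> by (intro mult_le_mono1) simp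
  finally show ?thesis .
qed

lemma blocks_eq_iff:
  assumes "\<And>i. i \<in> {1..n} \<Longrightarrow> b i \<in> carrier_vec N" "\<And>i. i \<in> {1..n} \<Longrightarrow> c i \<in> carrier_vec N"
  shows "blocks N n b = blocks N n c \<longleftrightarrow> (\<forall>i\<in>{1..n}. b i = c i)"
proof
  assume eq: "blocks N n b = blocks N n c"
  show "\<forall>i\<in>{1..n}. b i = c i"
  proof
    fix i assume i: "i \<in> {1..n}"
    show "b i = c i"
    proof (rule eq_vecI)
      fix r assume "r < dim_vec (c i)"
      then have r: "r < N" using assms(2)[OF i] by auto
      have "i - 1 < n" using i by auto
      then have "(i - 1) * N + r < n * N" using r by (rule block_index_less)
      moreover have "((i - 1) * N + r) div N = i - 1" "((i - 1) * N + r) mod N = r" using r by auto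
      ultimately show "b i $ r = c i $ r"
        using arg_cong[OF eq, of "\<lambda>v. v $ ((i - 1) * N + r)"] i by (simp add: blocks_def)
    qed (use assms(1)[OF i] assms(2)[OF i] in simp)
  qed
next
  assume *: "\<forall>i\<in>{1..n}. b i = c i"
  show "blocks N n b = blocks N n c"
  proof (rule eq_vecI)
    fix u assume "u < dim_vec (blocks N n c)"
    then have "u < n * N" by (simp add: blocks_def)
    then have "u div N + 1 \<in> {1..n}"
      by (simp add: less_mult_imp_div_less Suc_le_eq)
    then show "blocks N n b $ u = blocks N n c $ u" using * \<open>u < n * N\<close> by (simp add: blocks_def)
  qed (simp add: blocks_def)
qed

lemma blocks_smult:
  assumes "N \<ge> 1" "\<And>i. i \<in> {1..n} \<Longrightarrow> b i \<in> carrier_vec N"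
  shows "blocks N n (\<lambda>i. c \<cdot>\<^sub>v b i) = c \<cdot>\<^sub>v blocks N n b"
proof (rule eq_vecI)
  fix u assume "u < dim_vec (c \<cdot>\<^sub>v blocks N n b)"
  then have u: "u < n * N" by (simp add: blocks_def)
  then have "u div N + 1 \<in> {1..n}"
    by (simp add: less_mult_imp_div_less Suc_le_eq)
  then show "blocks N n (\<lambda>i. c \<cdot>\<^sub>v b i) $ u = (c \<cdot>\<^sub>v blocks N n b) $ u"
    using u assms(2)[of "u div N + 1"] assms(1) by (simp add: blocks_def)
qed (simp add: blocks_def)

lemma blocks_surj:
  fixes v :: "'a::zero vec"
  assumes "N \<ge> 1" "v \<in> carrier_vec (n * N)"
  obtains b where "b 0 = 0\<^sub>v N" "\<And>i. b i \<in> carrier_vec N" "blocks N n b = v"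
proof -
  \<comment> \<open>Block 0 is not recorded in \<open>v\<close>; it gets the value 0 that a based
    representation has at \<open>x 0\<close>.\<close>
  let ?b = "\<lambda>i. if i = 0 then 0\<^sub>v N else Matrix.vec N (\<lambda>r. v $ ((i - 1) * N + r))"
  have "blocks N n ?b = v"
    using assms by (intro eq_vecI) (auto simp: blocks_def)
  then show ?thesis by (intro that[of ?b]) simp_all
qed

definition eval_matrix ::
  "nat \<Rightarrow> nat \<Rightarrow> (nat \<Rightarrow> complex mat) \<Rightarrow> (nat \<Rightarrow> nat \<times> nat \<times> nat) \<Rightarrow> complex \<Rightarrow> complex mat" where
  "eval_matrix N n X \<rho> a = map_mat (\<lambda>f. laurent_eval f a) (twisted_matrix N n X \<rho>)"

lemma eval_matrix_carrier [simp]: "eval_matrix N n X \<rho> a \<in> carrier_mat (n * N) (n * N)"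
  by (simp add: eval_matrix_def twisted_matrix_def)

lemma laurent_eval_relation_block:
  assumes a: "a \<noteq> 0" and qr: "q < N" "r < N" and X: "\<And>i. X i \<in> carrier_mat N N"
  shows "laurent_eval (relation_block N X (i, j, k) l $$ (q, r)) a =
    (if l = i then (if q = r then 1 else 0) - a * X k $$ (q, r) else 0) +
    (if l = j then a * X i $$ (q, r) else 0) - (if l = k then (if q = r then 1 else 0) else 0)"
proof -
  interpret comm_ring_hom "\<lambda>f. laurent_eval f a" by (rule laurent_eval_hom[OF a])
  have [simp]: "dim_row (X i) = N" "dim_col (X i) = N" for i using X[of i] by auto
  show ?thesis
    using qr by (simp add: relation_block_def hom_add hom_minus laurent_t_def laurent_const_def
        mult_single)
qed

lemma eval_matrix_mult_blocks:
  assumes a: "a \<noteq> 0" and N: "N \<ge> 1" and X: "\<And>i. i \<le> n \<Longrightarrow> X i \<in> carrier_mat N N"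
    and b: "\<And>i. i \<le> n \<Longrightarrow> b i \<in> carrier_vec N" "b 0 = 0\<^sub>v N"
    and u: "u < n * N" and rho: "\<rho> (u div N + 1) = (i, j, k)" "i \<le> n" "j \<le> n" "k \<le> n"
  shows "(eval_matrix N n X \<rho> a *\<^sub>v blocks N n b) $ u =
    (b i + a \<cdot>\<^sub>v (X i *\<^sub>v b j)) $ (u mod N) - (b k + a \<cdot>\<^sub>v (X k *\<^sub>v b i)) $ (u mod N)"
proof -
  let ?q = "u mod N"
  have q: "?q < N" using N by simp
  \<comment> \<open>The matrices are known to have size \<open>N\<close> only for indices up to
    \<open>n\<close>; zero padding makes the entry formula applicable, which asks for the size at
    every index.\<close>
  define X' where "X' i = (if i \<le> n then X i else 0\<^sub>m N N)" for i
  have X': "X' i \<in> carrier_mat N N" for i using X by (simp add: X'_def)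
  have blk: "relation_block N X (i, j, k) l = relation_block N X' (i, j, k) l" for l
    using rho by (simp add: relation_block_def X'_def)
  let ?E = "\<lambda>l r. laurent_eval (relation_block N X (i, j, k) l $$ (?q, r)) a"
  let ?d = "\<lambda>r. if ?q = r then 1 else 0 :: complex"
  have delta: "(\<Sum>r<N. ?d r * b i $ r) = b i $ ?q" for i
  proof -
    have "(\<Sum>r<N. ?d r * b i $ r) = (\<Sum>r<N. if r = ?q then b i $ r else 0)"
      by (intro sum.cong) auto
    then show ?thesis using q by simp
  qed
  have "(eval_matrix N n X \<rho> a *\<^sub>v blocks N n b) $ u =
      (\<Sum>w<n * N. eval_matrix N n X \<rho> a $$ (u, w) * blocks N n b $ w)"
    using u by (simp add: eval_matrix_def twisted_matrix_def scalar_prod_def blocks_def lessThan_atLeast0)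
  also have "\<dots> = (\<Sum>w<n * N. ?E (w div N + 1) (w mod N) * b (w div N + 1) $ (w mod N))"
    using u rho by (intro sum.cong) (simp_all add: eval_matrix_def twisted_matrix_def blocks_def)
  also have "\<dots> = (\<Sum>l<n. \<Sum>r<N. ?E (l + 1) r * b (l + 1) $ r)"
    by (rule sum_div_mod[OF N, where f = "\<lambda>l r. ?E (l + 1) r * b (l + 1) $ r"])
  \<comment> \<open>Since \<open>b 0 = 0\<close>, the discarded column of \<open>x 0\<close> may be
    put back. The sum now covers every possible value of \<open>i\<close>, \<open>j\<close> and
    \<open>k\<close>, including 0.\<close>
  also have "\<dots> = (\<Sum>l<Suc n. \<Sum>r<N. ?E l r * b l $ r)"
    by (subst sum.lessThan_Suc_shift) (simp add: b(2))
  also have "\<dots> = (\<Sum>r<N. \<Sum>l<Suc n. ?E l r * b l $ r)"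
    by (rule sum.swap)
  also have "\<dots> = (\<Sum>r<N. (?d r - a * X k $$ (?q, r)) * b i $ r + a * X i $$ (?q, r) * b j $ r
      - ?d r * b k $ r)"
  proof (rule sum.cong[OF HOL.refl])
    fix r assume "r \<in> {..<N}"
    then have r: "r < N" by simp
    \<comment> \<open>The three conditions stay separate summands, so coincidences among
      \<open>i\<close>, \<open>j\<close>, \<open>k\<close> add up by themselves.\<close>
    have "?E l r * b l $ r =
        (if l = i then (?d r - a * X k $$ (?q, r)) * b l $ r else 0) +
        (if l = j then a * X i $$ (?q, r) * b l $ r else 0) - (if l = k then ?d r * b l $ r else 0)" for l
      unfolding blk laurent_eval_relation_block[where X = X', OF a q r X']
      using rho by (simp add: X'_def distrib_right left_diff_distrib)
    then show "(\<Sum>l<Suc n. ?E l r * b l $ r) =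
        (?d r - a * X k $$ (?q, r)) * b i $ r + a * X i $$ (?q, r) * b j $ r - ?d r * b k $ r"
      using rho by (simp only: sum.distrib sum_subtractf sum.delta finite_lessThan) simp
  qed
  also have "\<dots> = (\<Sum>r<N. ?d r * b i $ r) - a * (\<Sum>r<N. X k $$ (?q, r) * b i $ r)
      + a * (\<Sum>r<N. X i $$ (?q, r) * b j $ r) - (\<Sum>r<N. ?d r * b k $ r)"
    by (simp add: sum.distrib sum_subtractf left_diff_distrib sum_distrib_left mult.assoc)
  also have "\<dots> = b i $ ?q - a * (X k *\<^sub>v b i) $ ?q + a * (X i *\<^sub>v b j) $ ?q - b k $ ?q"
    unfolding delta
    using q X[OF rho(4)] X[OF rho(2)] b(1)[OF rho(2)] b(1)[OF rho(3)]
    by (simp add: scalar_prod_def lessThan_atLeast0)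
  finally show ?thesis
    using q X[OF rho(2)] X[OF rho(4)] b(1)[OF rho(2)] b(1)[OF rho(3)] b(1)[OF rho(4)]
    by (simp del: index_mult_mat_vec add: algebra_simps)
qed

text \<open>The \<open>N\<close> rows with the same quotient by \<open>N\<close> form one vector
  equation per relation; the subtracted terms of the block row are moved to the right.\<close>

lemma eval_matrix_kernel_iff:
  assumes a: "a \<noteq> 0" and N: "N \<ge> 1" and X: "\<And>i. i \<le> n \<Longrightarrow> X i \<in> carrier_mat N N"
    and b: "\<And>i. i \<le> n \<Longrightarrow> b i \<in> carrier_vec N" "b 0 = 0\<^sub>v N"
    and rho: "\<And>l i j k. l \<in> {1..n} \<Longrightarrow> \<rho> l = (i, j, k) \<Longrightarrow> i \<le> n \<and> j \<le> n \<and> k \<le> n"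
  shows "blocks N n b \<in> mat_kernel (eval_matrix N n X \<rho> a) \<longleftrightarrow>
    (\<forall>l\<in>{1..n}. \<forall>i j k. \<rho> l = (i, j, k) \<longrightarrow>
      b i + a \<cdot>\<^sub>v (X i *\<^sub>v b j) = b k + a \<cdot>\<^sub>v (X k *\<^sub>v b i))"
    (is "_ \<longleftrightarrow> ?rel")
proof -
  let ?M = "eval_matrix N n X \<rho> a"
  have ker: "blocks N n b \<in> mat_kernel ?M \<longleftrightarrow> (\<forall>u<n * N. (?M *\<^sub>v blocks N n b) $ u = 0)"
    unfolding mat_kernel[OF eval_matrix_carrier]
    by (auto simp: vec_eq_iff carrier_matD[OF eval_matrix_carrier] simp del: index_mult_mat_vec)
  show ?thesis unfolding ker
  proof
    assume zero: "\<forall>u<n * N. (?M *\<^sub>v blocks N n b) $ u = 0"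
    show ?rel
    proof (intro ballI allI impI)
      fix l i j k assume l: "l \<in> {1..n}" and eq: "\<rho> l = (i, j, k)"
      have ijk: "i \<le> n" "j \<le> n" "k \<le> n" using rho[OF l eq] by auto
      show "b i + a \<cdot>\<^sub>v (X i *\<^sub>v b j) = b k + a \<cdot>\<^sub>v (X k *\<^sub>v b i)"
      proof (rule eq_vecI)
        fix q assume "q < dim_vec (b k + a \<cdot>\<^sub>v (X k *\<^sub>v b i))"
        then have q: "q < N" using X[OF ijk(3)] by simp
        have "l - 1 < n" using l by auto
        then have u: "(l - 1) * N + q < n * N" using q by (rule block_index_less)
        have "((l - 1) * N + q) div N + 1 = l" "((l - 1) * N + q) mod N = q" using q l by auto
        then show "(b i + a \<cdot>\<^sub>v (X i *\<^sub>v b j)) $ q = (b k + a \<cdot>\<^sub>v (X k *\<^sub>v b i)) $ q"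
          using eval_matrix_mult_blocks[where X = X and b = b and i = i and j = j and k = k and \<rho> = \<rho>, OF a N X b u] zero u eq ijk by (simp del: index_mult_mat_vec)
      qed (use X[OF ijk(1)] X[OF ijk(3)] in simp)
    qed
  next
    assume rel: ?rel
    show "\<forall>u<n * N. (?M *\<^sub>v blocks N n b) $ u = 0"
    proof (intro allI impI)
      fix u assume u: "u < n * N"
      then have l: "u div N + 1 \<in> {1..n}" by (simp add: less_mult_imp_div_less Suc_le_eq)
      obtain i j k where eq: "\<rho> (u div N + 1) = (i, j, k)" by (cases "\<rho> (u div N + 1)") blast
      then have ijk: "i \<le> n" "j \<le> n" "k \<le> n" using rho[OF l eq] by auto
      show "(?M *\<^sub>v blocks N n b) $ u = 0"
        using eval_matrix_mult_blocks[where X = X and b = b and \<rho> = \<rho>, OF a N X b u eq ijk] bspec[OF rel l] eq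
        by (simp del: index_mult_mat_vec index_add_vec index_smult_vec)
    qed
  qed
qed

text \<open>All minors of size \<open>n * N - r + 1\<close> vanish at \<open>a\<close> iff the rank
  there is at most \<open>n * N - r\<close>, that is, the nullity is at least \<open>r\<close>. For
  \<open>r > n * N\<close> both sides are false, as \<open>D r = 1\<close> and the nullity is at
  most \<open>n * N\<close>.\<close>

lemma twisted_polynomial_eval_eq_0_iff:
  assumes a: "a \<noteq> 0" and D: "twisted_polynomials N n X \<rho> D" and r: "r \<ge> 1"
  shows "laurent_eval (D r) a = 0 \<longleftrightarrow>
    r \<le> vectorspace.dim class_ring
      ((module_vec TYPE(complex) (n * N))\<lparr>carrier := mat_kernel (eval_matrix N n X \<rho> a)\<rparr>)"
    (is "_ \<longleftrightarrow> r \<le> ?dim")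
proof -
  let ?M = "eval_matrix N n X \<rho> a"
  have dim: "vec_space.rank (n * N) ?M + ?dim = n * N"
    by (rule rank_nullity_mat(1)[OF eval_matrix_carrier])
  interpret comm_ring_hom "\<lambda>f. laurent_eval f a" by (rule laurent_eval_hom[OF a])
  show ?thesis
  proof (cases "r \<le> n * N")
    case True
    let ?s = "n * N - r + 1"
    have "is_gcd_of (D r) (minors ?s (twisted_matrix N n X \<rho>))"
      using D r True by (simp add: twisted_polynomials_def)
    then have "laurent_eval (D r) a = 0 \<longleftrightarrow>
        (\<forall>f\<in>minors ?s (twisted_matrix N n X \<rho>). laurent_eval f a = 0)"
      by (rule gcd_laurent_eval_eq_0_iff[OF a])
    also have "\<dots> \<longleftrightarrow> (\<forall>d\<in>minors ?s ?M. d = 0)"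
      unfolding eval_matrix_def minors_hom[OF laurent_eval_hom[OF a]] by blast
    also have "\<dots> \<longleftrightarrow> vec_space.rank (n * N) ?M < ?s"
      by (rule minors_vanish_iff_rank[OF eval_matrix_carrier])
    also have "\<dots> \<longleftrightarrow> r \<le> ?dim" using dim True by linarith
    finally show ?thesis .
  next
    case False
    then have "D r = 1" using D by (simp add: twisted_polynomials_def)
    then show ?thesis using False dim by simp
  qed
qed

section \<open>Representations of the Crowell group\<close>

definition map_word :: "('a \<Rightarrow> 'b) \<Rightarrow> 'a word \<Rightarrow> 'b word" where
  "map_word f = map (\<lambda>(b, a). (b, f a))"

lemma map_word_simps [simp]:
  "map_word f [] = []" "map_word f ((b, a) # w) = (b, f a) # map_word f w"
  "map_word f (v @ w) = map_word f v @ map_word f w"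
  by (simp_all add: map_word_def)

lemma map_word_words: "f \<in> X \<rightarrow> Y \<Longrightarrow> w \<in> words X \<Longrightarrow> map_word f w \<in> words Y"
  by (induction w) (auto simp: Pi_iff)

text \<open>Renaming letters compatibly with the relations carries derivations to derivations; this
  makes the action of \<open>S\<close> on classes of words well defined.\<close>

lemma pres_eq_map_word:
  assumes f: "f \<in> X \<rightarrow> Y"
    and rel: "\<And>l r. (l, r) \<in> R \<Longrightarrow> l \<in> words X \<Longrightarrow> r \<in> words X \<Longrightarrow> (map_word f l, map_word f r) \<in> Q"
    and "pres_eq X R v w"
  shows "pres_eq Y Q (map_word f v) (map_word f w)"
  using assms(3)
proof (induction rule: pres_eq.induct)
  case (refl w)
  then show ?case by (simp add: pres_eq.refl map_word_words[OF f])
next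
  case (sym v w)
  then show ?case by (simp add: pres_eq.sym)
next
  case (trans u v w)
  then show ?case using pres_eq.trans by blast
next
  case (cancel u v x b)
  then show ?case
    using pres_eq.cancel[of "map_word f u" Y "map_word f v" "f x" Q b] f
    by (auto simp: map_word_words[OF f])
next
  case (rel u v l r)
  then show ?case
    using pres_eq.rel[of "map_word f u" Y "map_word f v" "map_word f l" "map_word f r" Q] assms(2)
    by (simp add: map_word_words[OF f])
qed

lemma derived_relatorsI:
  "s \<in> S \<Longrightarrow> g \<in> carrier G \<Longrightarrow> h \<in> carrier G \<Longrightarrow>
    ([(True, (s, g \<otimes>\<^bsub>G\<^esub> h))], [(True, (s, g)), (True, (act s g, h))]) \<in> derived_relators G S act"
  unfolding derived_relators_def by blast

lemma derived_relatorsE: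
  assumes "(l, r) \<in> derived_relators G S act"
  obtains s g h where "s \<in> S" "g \<in> carrier G" "h \<in> carrier G"
    "l = [(True, (s, g \<otimes>\<^bsub>G\<^esub> h))]" "r = [(True, (s, g)), (True, (act s g, h))]"
  using assms unfolding derived_relators_def by blast

section \<open>The Crowell group and twisted homomorphisms\<close>

locale matrix_rep = group G for G :: "('g, 'b) monoid_scheme" (structure) +
  fixes \<gamma> :: "'g \<Rightarrow> complex mat" and N :: nat
  assumes rep: "\<gamma> \<in> hom G (GL N)" and dim_pos: "N \<ge> 1"
begin

abbreviation "S \<equiv> rep_image G \<gamma>"
abbreviation "X \<equiv> S \<times> carrier G"
abbreviation "R \<equiv> derived_relators G S (\<lambda>s g. s * \<gamma> g)"
abbreviation "P \<equiv> crowell_group G \<gamma>"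
abbreviation "gen \<equiv> crowell_gen G \<gamma>"
abbreviation "act \<equiv> crowell_act G \<gamma>"

lemma P_def: "P = presented_group X R"
  by (simp add: crowell_group_def derived_group_def)

lemma gen_def: "gen s g = word_class X R [(True, (s, g))]"
  by (simp add: crowell_gen_def derived_gen_def)

lemma P_group: "group P"
  by (simp add: P_def presented_group_is_group)

lemma rep_mult: "g \<in> carrier G \<Longrightarrow> h \<in> carrier G \<Longrightarrow> \<gamma> (g \<otimes> h) = \<gamma> g * \<gamma> h"
  using rep by (simp add: hom_def GL_simps)

lemma rep_GL: "g \<in> carrier G \<Longrightarrow> \<gamma> g \<in> carrier (GL N)"
  using rep by (auto simp: hom_def)

lemma rep_carrier: "g \<in> carrier G \<Longrightarrow> \<gamma> g \<in> carrier_mat N N"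
  using rep_GL GL_carrierD by blast

lemma rep_one: "\<gamma> \<one> = 1\<^sub>m N"
  using hom_one[OF rep is_group GL_group] by (simp add: GL_simps)

lemma S_carrier: "s \<in> S \<Longrightarrow> s \<in> carrier_mat N N"
  using rep_carrier by blast

lemma S_one: "1\<^sub>m N \<in> S"
  using rep_one one_closed by (metis image_eqI)

lemma S_mult: "s \<in> S \<Longrightarrow> t \<in> S \<Longrightarrow> s * t \<in> S"
proof -
  assume "s \<in> S" "t \<in> S"
  then obtain g h where "s = \<gamma> g" "t = \<gamma> h" "g \<in> carrier G" "h \<in> carrier G" by auto
  then have "s * t = \<gamma> (g \<otimes> h)" "g \<otimes> h \<in> carrier G" by (simp_all add: rep_mult)
  then show ?thesis by blast
qed

lemma gen_closed: "s \<in> S \<Longrightarrow> g \<in> carrier G \<Longrightarrow> gen s g \<in> carrier P"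
  by (auto simp: P_def gen_def carrier_presented)

lemma gen_mult:
  assumes s: "s \<in> S" and g: "g \<in> carrier G" and h: "h \<in> carrier G"
  shows "gen s (g \<otimes> h) = gen s g \<otimes>\<^bsub>P\<^esub> gen (s * \<gamma> g) h"
proof -
  have sg: "s * \<gamma> g \<in> S" using S_mult s g by blast
  have "([(True, (s, g \<otimes> h))], [(True, (s, g)), (True, (s * \<gamma> g, h))]) \<in> R"
    using s g h by (rule derived_relatorsI)
  then have "pres_eq X R ([] @ [(True, (s, g \<otimes> h))] @ []) ([] @ [(True, (s, g)), (True, (s * \<gamma> g, h))] @ [])"
    using s g h sg by (intro pres_eq.rel) auto
  then show ?thesis
    using s g h sg by (simp add: P_def gen_def presented_mult word_class_eq_iff)
qed

lemma P_presentation: "has_presentation P X (\<lambda>(s, g). gen s g) R"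
proof -
  have "(\<lambda>(s, g). gen s g) = (\<lambda>a. word_class X R [(True, a)])" by (auto simp: gen_def)
  then show ?thesis using presented_group_has_presentation[of X R] by (simp add: P_def)
qed

text \<open>Left multiplication by \<open>s\<close> commutes with the right action of the group on
  \<open>S\<close>, by associativity, and so sends derived relators to derived relators.\<close>

lemma act_word_class:
  assumes s: "s \<in> S" and w: "w \<in> words X"
  shows "act s (word_class X R w) = word_class X R (map_word (\<lambda>(t, g). (s * t, g)) w)"
proof -
  let ?f = "\<lambda>(t, g). (s * t, g)"
  have f: "?f \<in> X \<rightarrow> X" using S_mult[OF s] by auto
  have rel: "(map_word ?f l, map_word ?f r) \<in> R" if lr: "(l, r) \<in> R" for l r
  proof -
    obtain t g h where *: "t \<in> S" "g \<in> carrier G" "h \<in> carrier G"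
      "l = [(True, (t, g \<otimes> h))]" "r = [(True, (t, g)), (True, (t * \<gamma> g, h))]"
      using lr by (rule derived_relatorsE)
    have "s * (t * \<gamma> g) = s * t * \<gamma> g"
      using S_carrier[OF s] S_carrier[OF *(1)] rep_carrier[OF *(2)] by (simp add: assoc_mult_mat)
    then show ?thesis
      using derived_relatorsI[of "s * t" S g G h "\<lambda>s g. s * \<gamma> g"] *(2-) S_mult[OF s *(1)] by simp
  qed
  have eq: "word_class X R (map_word ?f v) = word_class X R (map_word ?f w)"
    if "v \<in> word_class X R w" for v
  proof -
    have "pres_eq X R (map_word ?f w) (map_word ?f v)"
      by (rule pres_eq_map_word[OF f]) (use rel that in \<open>simp_all add: word_class_def\<close>)
    then show ?thesis by (rule word_class_eqI[symmetric])
  qed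
  have "act s (word_class X R w) = (\<Union>v\<in>word_class X R w. word_class X R (map_word ?f v))"
    by (simp add: crowell_act_def map_word_def case_prod_beta')
  also have "\<dots> = (\<Union>v\<in>word_class X R w. word_class X R (map_word ?f w))"
    by (intro SUP_cong HOL.refl eq)
  also have "\<dots> = word_class X R (map_word ?f w)"
    using word_class_self[OF w, of R] by auto
  finally show ?thesis .
qed

lemma act_gen:
  assumes "s \<in> S" "t \<in> S" "g \<in> carrier G"
  shows "act s (gen t g) = gen (s * t) g"
  using assms by (simp add: gen_def act_word_class)

lemma act_hom: assumes s: "s \<in> S" shows "act s \<in> hom P P"
proof -
  have f: "(\<lambda>(t, g). (s * t, g)) \<in> X \<rightarrow> X" using S_mult[OF s] by auto
  show ?thesis
    unfolding P_def
    by (rule homI) (auto simp: carrier_presented act_word_class[OF s] presented_mult map_word_words[OF f])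
qed

abbreviation "D \<equiv> dilation_group N"
abbreviation "K \<equiv> twisted_dilations N"
abbreviation "S_reps \<equiv> S_hom S P act D (dilation_act N)"

text \<open>Applying \<open>s\<close> to the law for \<open>\<beta>\<close> yields precisely the
  derived relation at \<open>s\<close>, so von Dyck's theorem for the Crowell group produces
  \<open>\<delta>\<close>.\<close>

lemma S_rep_of_hom:
  assumes \<phi>: "(\<lambda>g. (a g, \<gamma> g, \<beta> g)) \<in> hom G K"
  obtains \<delta> where "\<delta> \<in> S_reps \<inter> extensional (carrier P)"
    and "\<And>s g. s \<in> S \<Longrightarrow> g \<in> carrier G \<Longrightarrow> \<delta> (gen s g) = dilation N (a g) (s *\<^sub>v \<beta> g)"
proof -
  have a: "a g \<noteq> 0" and \<beta>: "\<beta> g \<in> carrier_vec N" if "g \<in> carrier G" for g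
    using \<phi> that by (auto simp: hom_def Pi_iff)
  have cocycle: "a (g \<otimes> h) = a g * a h" "\<beta> (g \<otimes> h) = a h \<cdot>\<^sub>v \<beta> g + \<gamma> g *\<^sub>v \<beta> h"
    if "g \<in> carrier G" "h \<in> carrier G" for g h
    using \<phi> that by (auto simp: hom_def)
  let ?f = "\<lambda>(s, g). dilation N (a g) (s *\<^sub>v \<beta> g)"
  have f: "?f \<in> X \<rightarrow> carrier D"
    using a \<beta> S_carrier by (auto intro!: dilation_closed mult_mat_vec_carrier)
  interpret D: group D by (rule dilation_group_is_group)
  have rel: "word_val D ?f l = word_val D ?f r" if lr: "(l, r) \<in> R" for l r
  proof -
    obtain s g h where *: "s \<in> S" "g \<in> carrier G" "h \<in> carrier G"
      "l = [(True, (s, g \<otimes> h))]" "r = [(True, (s, g)), (True, (s * \<gamma> g, h))]"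
      using lr by (rule derived_relatorsE)
    note c = S_carrier[OF *(1)] rep_carrier[OF *(2)] \<beta>[OF *(2)] \<beta>[OF *(3)]
    have cl: "dilation N (a k) (t *\<^sub>v \<beta> k) \<in> carrier D" if "t \<in> S" "k \<in> carrier G" for t k
      using funcset_mem[OF f, of "(t, k)"] that by simp
    have "s *\<^sub>v \<beta> (g \<otimes> h) = s *\<^sub>v (a h \<cdot>\<^sub>v \<beta> g) + s *\<^sub>v (\<gamma> g *\<^sub>v \<beta> h)"
      unfolding cocycle(2)[OF *(2,3)] using c by (intro mult_add_distrib_mat_vec) auto
    also have "\<dots> = a h \<cdot>\<^sub>v (s *\<^sub>v \<beta> g) + s * \<gamma> g *\<^sub>v \<beta> h"
      using mult_mat_vec[OF c(1,3)] assoc_mult_mat_vec[OF c(1,2,4)] by simp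
    finally have "dilation N (a g) (s *\<^sub>v \<beta> g) \<otimes>\<^bsub>D\<^esub> dilation N (a h) (s * \<gamma> g *\<^sub>v \<beta> h)
        = dilation N (a (g \<otimes> h)) (s *\<^sub>v \<beta> (g \<otimes> h))"
      using c *(2,3) by (subst dilation_mult) (auto simp: cocycle(1))
    then show ?thesis
      using * cl[of s "g \<otimes> h"] cl[of "s * \<gamma> g" h] S_mult[of s "\<gamma> g"] by simp
  qed
  have "\<exists>\<delta>\<in>hom P D. \<forall>i\<in>X. \<delta> (case i of (s, g) \<Rightarrow> gen s g) = ?f i"
    by (rule has_presentation_extend[OF P_group dilation_group_is_group P_presentation f rel])
  then obtain \<delta> where \<delta>: "\<delta> \<in> hom P D" "\<And>i. i \<in> X \<Longrightarrow> \<delta> (case i of (s, g) \<Rightarrow> gen s g) = ?f i"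
    by blast
  have val: "\<delta> (gen s g) = dilation N (a g) (s *\<^sub>v \<beta> g)" if "s \<in> S" "g \<in> carrier G" for s g
    using \<delta>(2)[of "(s, g)"] that by simp
  interpret P: group P by (rule P_group)
  have equiv: "\<delta> (act s C) = dilation_act N s (\<delta> C)" if s: "s \<in> S" and C: "C \<in> carrier P" for s C
  proof -
    \<comment> \<open>Both composites are homomorphisms, so equivariance only has to be checked on
      generators, where it is associativity of the matrix action.\<close>
    have "(\<delta> \<circ> act s) C = (dilation_act N s \<circ> \<delta>) C"
    proof (rule has_presentation_hom_eqI[OF P_group dilation_group_is_group P_presentation _ _ _ C])
      show "\<delta> \<circ> act s \<in> hom P D" using Group.hom_compose[OF act_hom[OF s] \<delta>(1)] .
      show "dilation_act N s \<circ> \<delta> \<in> hom P D"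
        using Group.hom_compose[OF \<delta>(1) dilation_act_hom[OF S_carrier[OF s]]] .
      fix i assume "i \<in> X"
      then obtain t g where i: "i = (t, g)" "t \<in> S" "g \<in> carrier G" by auto
      have "s * t *\<^sub>v \<beta> g = s *\<^sub>v (t *\<^sub>v \<beta> g)"
        using i s by (intro assoc_mult_mat_vec[of _ N N _ N] S_carrier \<beta>)
      then show "(\<delta> \<circ> act s) (case i of (s, g) \<Rightarrow> gen s g) =
          (dilation_act N s \<circ> \<delta>) (case i of (s, g) \<Rightarrow> gen s g)"
        using i s S_mult S_carrier \<beta>
        by (simp add: act_gen val dilation_act_dilation[OF S_carrier[OF s]] mult_mat_vec_carrier[OF S_carrier])
    qed
    then show ?thesis by simp
  qed
  \<comment> \<open>The values outside the carrier are fixed to make the map extensional, as in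
    \<open>based_reps\<close>.\<close>
  have "restrict \<delta> (carrier P) \<in> hom P D"
    using \<delta>(1) by (auto simp: hom_def Pi_iff)
  moreover have "act s C \<in> carrier P" if "s \<in> S" "C \<in> carrier P" for s C
    using act_hom[OF that(1)] that(2) by (auto simp: hom_def)
  ultimately have "restrict \<delta> (carrier P) \<in> S_reps \<inter> extensional (carrier P)"
    using equiv by (auto simp: S_hom_def)
  then show ?thesis
    by (rule that) (simp add: gen_closed val)
qed

text \<open>Equivariance moves the index \<open>s\<close> into the translation part. The derived
  relation at the identity matrix then has second factor with translation \<gamma>(g) \<beta>(h),
  and comparing ratios and translations gives both laws.\<close>

lemma hom_of_S_rep:
  assumes \<delta>: "\<delta> \<in> S_reps"
  obtains a \<beta> where "(\<lambda>g. (a g, \<gamma> g, \<beta> g)) \<in> hom G K"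
    and "\<And>s g. s \<in> S \<Longrightarrow> g \<in> carrier G \<Longrightarrow> \<delta> (gen s g) = dilation N (a g) (s *\<^sub>v \<beta> g)"
proof -
  have hom: "\<delta> \<in> hom P D" and equiv: "\<And>s C. s \<in> S \<Longrightarrow> C \<in> carrier P \<Longrightarrow> \<delta> (act s C) = dilation_act N s (\<delta> C)"
    using \<delta> by (auto simp: S_hom_def)
  have "\<exists>a b. a \<noteq> 0 \<and> b \<in> carrier_vec N \<and> \<delta> (gen (1\<^sub>m N) g) = dilation N a b" if "g \<in> carrier G" for g
  proof -
    have "\<delta> (gen (1\<^sub>m N) g) \<in> carrier D"
      using hom gen_closed[OF S_one that] by (auto simp: hom_def)
    then show ?thesis by (auto simp: dilation_group_def)
  qed
  then obtain a \<beta> where ab: "\<And>g. g \<in> carrier G \<Longrightarrow> a g \<noteq> 0"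
    "\<And>g. g \<in> carrier G \<Longrightarrow> \<beta> g \<in> carrier_vec N"
    "\<And>g. g \<in> carrier G \<Longrightarrow> \<delta> (gen (1\<^sub>m N) g) = dilation N (a g) (\<beta> g)"
    by metis
  have val: "\<delta> (gen s g) = dilation N (a g) (s *\<^sub>v \<beta> g)" if "s \<in> S" "g \<in> carrier G" for s g
  proof -
    have "gen s g = act s (gen (1\<^sub>m N) g)"
      using act_gen[OF that(1) S_one that(2)] S_carrier[OF that(1)] by simp
    then show ?thesis
      using equiv[OF that(1) gen_closed[OF S_one that(2)]] ab that
      by (simp add: dilation_act_dilation S_carrier)
  qed
  have "(\<lambda>g. (a g, \<gamma> g, \<beta> g)) \<in> hom G K"
  proof (rule homI)
    fix g assume "g \<in> carrier G"
    then show "(a g, \<gamma> g, \<beta> g) \<in> carrier K" using ab rep_GL by simp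
  next
    fix g h assume gh: "g \<in> carrier G" "h \<in> carrier G"
    have "dilation N (a (g \<otimes> h)) (\<beta> (g \<otimes> h)) = \<delta> (gen (1\<^sub>m N) g \<otimes>\<^bsub>P\<^esub> gen (1\<^sub>m N * \<gamma> g) h)"
      using gen_mult[OF S_one gh] ab gh by (metis m_closed)
    also have "\<dots> = \<delta> (gen (1\<^sub>m N) g) \<otimes>\<^bsub>D\<^esub> \<delta> (gen (\<gamma> g) h)"
      using hom gen_closed[OF S_one gh(1)] gen_closed[of "\<gamma> g" h] gh rep_carrier[OF gh(1)]
      by (auto simp: hom_def)
    also have "\<dots> = dilation N (a g * a h) (a h \<cdot>\<^sub>v \<beta> g + \<gamma> g *\<^sub>v \<beta> h)"
      using gh ab rep_carrier by (simp add: val dilation_mult mult_mat_vec_carrier[OF rep_carrier])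
    finally have "a (g \<otimes> h) = a g * a h \<and> \<beta> (g \<otimes> h) = a h \<cdot>\<^sub>v \<beta> g + \<gamma> g *\<^sub>v \<beta> h"
      using dilation_eqD[OF dim_pos] ab gh by (metis add_carrier_vec m_closed mult_mat_vec_carrier rep_carrier smult_carrier_vec)
    then show "(a (g \<otimes> h), \<gamma> (g \<otimes> h), \<beta> (g \<otimes> h)) = (a g, \<gamma> g, \<beta> g) \<otimes>\<^bsub>K\<^esub> (a h, \<gamma> h, \<beta> h)"
      using gh by (simp add: rep_mult)
  qed
  then show ?thesis using val that by blast
qed

lemma P_hom_eqI:
  assumes "group H" "\<delta> \<in> hom P H" "\<delta>' \<in> hom P H"
    and "\<And>s g. s \<in> S \<Longrightarrow> g \<in> carrier G \<Longrightarrow> \<delta> (gen s g) = \<delta>' (gen s g)" "C \<in> carrier P"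
  shows "\<delta> C = \<delta>' C"
  by (rule has_presentation_hom_eqI[OF P_group assms(1) P_presentation assms(2,3) _ assms(5)])
    (use assms(4) in auto)

end

section \<open>Based representations and the kernel of the evaluated matrix\<close>

locale wirtinger_rep = matrix_rep G \<gamma> N for G :: "('g, 'b) monoid_scheme" (structure) and \<gamma> N +
  fixes n :: nat and x :: "nat \<Rightarrow> 'g" and \<rho> :: "nat \<Rightarrow> nat \<times> nat \<times> nat"
  assumes presentation: "has_presentation G {0..n} x (wirtinger_relators n \<rho>)"
    and relation_bounds: "\<And>l i j k. l \<in> {1..n} \<Longrightarrow> \<rho> l = (i, j, k) \<Longrightarrow> i \<le> n \<and> j \<le> n \<and> k \<le> n"
begin

abbreviation "reps \<equiv> based_reps N G \<gamma> n x"
abbreviation "rvec \<equiv> rep_vec N G \<gamma> n x"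
abbreviation "M \<equiv> eval_matrix N n (\<lambda>i. \<gamma> (x i)) \<rho>"

lemma gens: "i \<le> n \<Longrightarrow> x i \<in> carrier G"
  using presentation by (auto simp: has_presentation_def)

lemma wirtinger_relation:
  assumes l: "l \<in> {1..n}" and eq: "\<rho> l = (i, j, k)"
  shows "x i \<otimes> x j = x k \<otimes> x i"
proof -
  have ijk: "i \<le> n" "j \<le> n" "k \<le> n" using relation_bounds[OF l eq] by auto
  have pres_val: "word_val G x v = word_val G x w"
    if "pres_eq {0..n} (wirtinger_relators n \<rho>) v w" for v w
    using that pres_eq_words[OF that] presentation unfolding has_presentation_def by blast
  have "([(True, i), (True, j)], [(True, k), (True, i)]) \<in> wirtinger_relators n \<rho>"
    unfolding wirtinger_relators_def using l eq by blast
  then have "pres_eq {0..n} (wirtinger_relators n \<rho>)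
      ([] @ [(True, i), (True, j)] @ []) ([] @ [(True, k), (True, i)] @ [])"
    using ijk by (intro pres_eq.rel) auto
  then have "word_val G x [(True, i), (True, j)] = word_val G x [(True, k), (True, i)]"
    by (intro pres_val) simp
  then show ?thesis using gens ijk by simp
qed

text \<open>The law for \<beta> carries \<alpha> in front of the translations, the module relation
  carries t in front of the matrices. Multiplication by \<alpha> matches them at t = \<alpha>^-1,
  the origin of the evaluation point.\<close>

lemma scaled_relation_iff:
  assumes "\<alpha> \<noteq> 0" "b \<in> carrier_vec N" "c \<in> carrier_vec N" "d \<in> carrier_vec N" "e \<in> carrier_vec N"
  shows "b + inverse \<alpha> \<cdot>\<^sub>v c = d + inverse \<alpha> \<cdot>\<^sub>v (e :: complex vec) \<longleftrightarrow> \<alpha> \<cdot>\<^sub>v b + c = \<alpha> \<cdot>\<^sub>v d + e"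
proof -
  have "b $ q + inverse \<alpha> * c $ q = d $ q + inverse \<alpha> * e $ q \<longleftrightarrow> \<alpha> * b $ q + c $ q = \<alpha> * d $ q + e $ q" for q
    using assms(1) by (auto simp: field_simps)
  then show ?thesis using assms(2-) by (auto simp: vec_eq_iff)
qed

lemma kernel_iff:
  assumes "\<alpha> \<noteq> 0" "\<And>i. i \<le> n \<Longrightarrow> b i \<in> carrier_vec N" "b 0 = 0\<^sub>v N"
  shows "blocks N n b \<in> mat_kernel (M (inverse \<alpha>)) \<longleftrightarrow>
    (\<forall>l\<in>{1..n}. \<forall>i j k. \<rho> l = (i, j, k) \<longrightarrow>
      b i + inverse \<alpha> \<cdot>\<^sub>v (\<gamma> (x i) *\<^sub>v b j) = b k + inverse \<alpha> \<cdot>\<^sub>v (\<gamma> (x k) *\<^sub>v b i))"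
proof (rule eval_matrix_kernel_iff)
  show "inverse \<alpha> \<noteq> 0" using assms(1) by simp
  show "\<gamma> (x i) \<in> carrier_mat N N" if "i \<le> n" for i using rep_carrier gens that by blast
  show "i \<le> n \<and> j \<le> n \<and> k \<le> n" if "l \<in> {1..n}" "\<rho> l = (i, j, k)" for l i j k
    by (rule relation_bounds[OF that])
qed (fact dim_pos assms)+

text \<open>A based representation sends \<open>\<^sup>sg\<close> to the dilation with ratio \<open>a g\<close> and translation
  part \<open>s (\<beta> g)\<close>.\<close>

definition rep_data :: "complex \<Rightarrow> ('g \<Rightarrow> complex) \<Rightarrow> ('g \<Rightarrow> complex vec) \<Rightarrow> bool" where
  "rep_data \<alpha> a \<beta> \<longleftrightarrow> (\<lambda>g. (a g, \<gamma> g, \<beta> g)) \<in> hom G K \<and> (\<forall>i\<le>n. a (x i) = \<alpha>) \<and> \<beta> (x 0) = 0\<^sub>v N"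

lemma rep_dataD:
  assumes "rep_data \<alpha> a \<beta>"
  shows "(\<lambda>g. (a g, \<gamma> g, \<beta> g)) \<in> hom G K" "i \<le> n \<Longrightarrow> a (x i) = \<alpha>" "\<beta> (x 0) = 0\<^sub>v N"
    and "g \<in> carrier G \<Longrightarrow> a g \<noteq> 0" "g \<in> carrier G \<Longrightarrow> \<beta> g \<in> carrier_vec N"
    and "g \<in> carrier G \<Longrightarrow> h \<in> carrier G \<Longrightarrow> a (g \<otimes> h) = a g * a h"
    and "g \<in> carrier G \<Longrightarrow> h \<in> carrier G \<Longrightarrow> \<beta> (g \<otimes> h) = a h \<cdot>\<^sub>v \<beta> g + \<gamma> g *\<^sub>v \<beta> h"
  using assms by (auto simp: rep_data_def hom_def Pi_iff)

lemma kernel_of_rep_data: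
  assumes \<alpha>: "\<alpha> \<noteq> 0" and d: "rep_data \<alpha> a \<beta>"
  shows "blocks N n (\<lambda>i. \<beta> (x i)) \<in> mat_kernel (M (inverse \<alpha>))"
proof -
  note \<beta> = rep_dataD(5)[OF d]
  have "\<beta> (x i) + inverse \<alpha> \<cdot>\<^sub>v (\<gamma> (x i) *\<^sub>v \<beta> (x j)) = \<beta> (x k) + inverse \<alpha> \<cdot>\<^sub>v (\<gamma> (x k) *\<^sub>v \<beta> (x i))"
    if l: "l \<in> {1..n}" and eq: "\<rho> l = (i, j, k)" for l i j k
  proof -
    have ijk: "i \<le> n" "j \<le> n" "k \<le> n" using relation_bounds[OF l eq] by auto
    have "\<beta> (x i \<otimes> x j) = a (x j) \<cdot>\<^sub>v \<beta> (x i) + \<gamma> (x i) *\<^sub>v \<beta> (x j)"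
      "\<beta> (x k \<otimes> x i) = a (x i) \<cdot>\<^sub>v \<beta> (x k) + \<gamma> (x k) *\<^sub>v \<beta> (x i)"
      using rep_dataD(7)[OF d] ijk gens by simp_all
    then have "\<alpha> \<cdot>\<^sub>v \<beta> (x i) + \<gamma> (x i) *\<^sub>v \<beta> (x j) = \<alpha> \<cdot>\<^sub>v \<beta> (x k) + \<gamma> (x k) *\<^sub>v \<beta> (x i)"
      using wirtinger_relation[OF l eq] rep_dataD(2)[OF d] ijk by simp
    moreover have "\<gamma> (x i) *\<^sub>v \<beta> (x j) \<in> carrier_vec N" "\<gamma> (x k) *\<^sub>v \<beta> (x i) \<in> carrier_vec N"
      using ijk gens \<beta> rep_carrier by (auto intro!: mult_mat_vec_carrier)
    ultimately show ?thesis
      using scaled_relation_iff[OF \<alpha>] ijk gens \<beta> by simp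
  qed
  then show ?thesis
    by (intro iffD2[OF kernel_iff[OF \<alpha>]] \<beta>[OF gens] rep_dataD(3)[OF d]) blast+
qed

text \<open>Von Dyck's theorem for the triples \<open>?f i\<close>: on a Wirtinger relation the
  ratios agree trivially, the matrices because \<gamma> is a homomorphism, and the translations by
  the kernel equation.\<close>

lemma rep_data_of_kernel:
  assumes \<alpha>: "\<alpha> \<noteq> 0" and v: "v \<in> mat_kernel (M (inverse \<alpha>))"
  shows "\<exists>a \<beta>. rep_data \<alpha> a \<beta> \<and> blocks N n (\<lambda>i. \<beta> (x i)) = v"
proof -
  have "v \<in> carrier_vec (n * N)" using v mat_kernel_carrier[OF eval_matrix_carrier] by blast
  then obtain b where b: "b 0 = 0\<^sub>v N" "\<And>i. b i \<in> carrier_vec N" "blocks N n b = v"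
    by (rule blocks_surj[OF dim_pos]) (rule that)
  have rel: "b i + inverse \<alpha> \<cdot>\<^sub>v (\<gamma> (x i) *\<^sub>v b j) = b k + inverse \<alpha> \<cdot>\<^sub>v (\<gamma> (x k) *\<^sub>v b i)"
    if "l \<in> {1..n}" "\<rho> l = (i, j, k)" for l i j k
    using v that kernel_iff[OF \<alpha>, of b] b by blast
  interpret K: group K by (rule twisted_dilations_group)
  let ?f = "\<lambda>i. (\<alpha>, \<gamma> (x i), b i)"
  have f: "?f \<in> {0..n} \<rightarrow> carrier K" using \<alpha> b gens rep_GL by auto
  have "word_val K ?f w = word_val K ?f w'" if ww: "(w, w') \<in> wirtinger_relators n \<rho>" for w w'
  proof -
    obtain i j k l where *: "w = [(True, i), (True, j)]" "w' = [(True, k), (True, i)]"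
      "l \<in> {1..n}" "\<rho> l = (i, j, k)"
      using ww unfolding wirtinger_relators_def by blast
    have ijk: "i \<le> n" "j \<le> n" "k \<le> n" using relation_bounds[OF *(3,4)] by auto
    have "\<gamma> (x i) * \<gamma> (x j) = \<gamma> (x k) * \<gamma> (x i)"
      using arg_cong[OF wirtinger_relation[OF *(3,4)], of \<gamma>] ijk gens by (simp add: rep_mult)
    moreover have "\<gamma> (x i) *\<^sub>v b j \<in> carrier_vec N" "\<gamma> (x k) *\<^sub>v b i \<in> carrier_vec N"
      using ijk gens b rep_carrier by (auto intro!: mult_mat_vec_carrier)
    then have "\<alpha> \<cdot>\<^sub>v b i + \<gamma> (x i) *\<^sub>v b j = \<alpha> \<cdot>\<^sub>v b k + \<gamma> (x k) *\<^sub>v b i"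
      using scaled_relation_iff[OF \<alpha>] b(2) rel[OF *(3,4)] by simp
    ultimately have "?f i \<otimes>\<^bsub>K\<^esub> ?f j = ?f k \<otimes>\<^bsub>K\<^esub> ?f i" by simp
    moreover have "?f i \<in> carrier K" "?f j \<in> carrier K" "?f k \<in> carrier K"
      using f ijk by auto
    ultimately show ?thesis using * by (simp del: twisted_dilations_simps)
  qed
  then have "\<exists>\<phi>\<in>hom G K. \<forall>i\<in>{0..n}. \<phi> (x i) = ?f i"
    by (intro has_presentation_extend[OF is_group twisted_dilations_group presentation f])
  then obtain \<phi> where \<phi>: "\<phi> \<in> hom G K" "\<And>i. i \<le> n \<Longrightarrow> \<phi> (x i) = ?f i" by auto
  \<comment> \<open>The extension was prescribed on generators only. Its matrix component is a
    homomorphism agreeing with \<gamma> on them, hence equals \<gamma> everywhere.\<close>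
  have snd_hom: "fst \<circ> (snd \<circ> \<phi>) \<in> hom G (GL N)"
  proof (rule homI)
    fix g assume "g \<in> carrier G"
    then have "\<phi> g \<in> carrier K" using \<phi>(1) by (auto simp: hom_def)
    then show "(fst \<circ> (snd \<circ> \<phi>)) g \<in> carrier (GL N)" by (cases "\<phi> g") auto
  next
    fix g h assume "g \<in> carrier G" "h \<in> carrier G"
    then have "\<phi> (g \<otimes> h) = \<phi> g \<otimes>\<^bsub>K\<^esub> \<phi> h" using \<phi>(1) by (auto simp: hom_def)
    then show "(fst \<circ> (snd \<circ> \<phi>)) (g \<otimes> h) = (fst \<circ> (snd \<circ> \<phi>)) g \<otimes>\<^bsub>GL N\<^esub> (fst \<circ> (snd \<circ> \<phi>)) h"
      by (cases "\<phi> g"; cases "\<phi> h") (simp add: GL_simps)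
  qed
  have "(fst \<circ> (snd \<circ> \<phi>)) g = \<gamma> g" if "g \<in> carrier G" for g
    by (rule has_presentation_hom_eqI[OF is_group GL_group presentation snd_hom rep _ that])
      (simp add: \<phi>(2))
  then have eq: "\<phi> g = (fst (\<phi> g), \<gamma> g, snd (snd (\<phi> g)))" if "g \<in> carrier G" for g
    using that by (simp add: prod_eq_iff)
  have "(\<lambda>g. (fst (\<phi> g), \<gamma> g, snd (snd (\<phi> g)))) \<in> hom G K"
  proof (rule homI)
    fix g assume g: "g \<in> carrier G"
    then have "\<phi> g \<in> carrier K" using \<phi>(1) by (auto simp: hom_def)
    then show "(fst (\<phi> g), \<gamma> g, snd (snd (\<phi> g))) \<in> carrier K" using eq[OF g] by metis
  next
    fix g h assume gh: "g \<in> carrier G" "h \<in> carrier G"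
    then have "\<phi> (g \<otimes> h) = \<phi> g \<otimes>\<^bsub>K\<^esub> \<phi> h" using \<phi>(1) by (auto simp: hom_def)
    then show "(fst (\<phi> (g \<otimes> h)), \<gamma> (g \<otimes> h), snd (snd (\<phi> (g \<otimes> h)))) =
        (fst (\<phi> g), \<gamma> g, snd (snd (\<phi> g))) \<otimes>\<^bsub>K\<^esub> (fst (\<phi> h), \<gamma> h, snd (snd (\<phi> h)))"
      using eq[OF gh(1)] eq[OF gh(2)] eq[OF m_closed[OF gh]] by metis
  qed
  moreover have "blocks N n (\<lambda>i. snd (snd (\<phi> (x i)))) = v"
    unfolding b(3)[symmetric] using \<phi>(2) b(2) by (subst blocks_eq_iff) auto
  ultimately have "rep_data \<alpha> (\<lambda>g. fst (\<phi> g)) (\<lambda>g. snd (snd (\<phi> g))) \<and>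
      blocks N n (\<lambda>i. snd (snd (\<phi> (x i)))) = v"
    using \<phi>(2) b(1) by (simp add: rep_data_def)
  then show ?thesis by blast
qed

lemma rep_data_of_based_rep:
  assumes \<delta>: "\<delta> \<in> reps \<alpha>"
  shows "\<exists>a \<beta>. rep_data \<alpha> a \<beta> \<and> rvec \<delta> = blocks N n (\<lambda>i. \<beta> (x i)) \<and>
    (\<forall>s\<in>S. \<forall>g\<in>carrier G. \<delta> (gen s g) = dilation N (a g) (s *\<^sub>v \<beta> g))"
proof -
  have "\<delta> \<in> S_reps" using \<delta> by (simp add: based_reps_def)
  then obtain a \<beta> where \<phi>: "(\<lambda>g. (a g, \<gamma> g, \<beta> g)) \<in> hom G K"
    and val: "\<And>s g. s \<in> S \<Longrightarrow> g \<in> carrier G \<Longrightarrow> \<delta> (gen s g) = dilation N (a g) (s *\<^sub>v \<beta> g)"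
    by (rule hom_of_S_rep) blast
  have \<beta>: "\<beta> g \<in> carrier_vec N" if "g \<in> carrier G" for g
    using \<phi> that by (auto simp: hom_def Pi_iff)
  have one: "\<delta> (gen (1\<^sub>m N) (x i)) = dilation N (a (x i)) (\<beta> (x i))" if "i \<le> n" for i
    using val[OF S_one gens[OF that]] \<beta>[OF gens[OF that]] by simp
  have "a (x i) = \<alpha>" if i: "i \<le> n" for i
  proof -
    obtain b where "b \<in> carrier_vec N" "\<delta> (gen (1\<^sub>m N) (x i)) = dilation N \<alpha> b"
      using \<delta> i by (auto simp: based_reps_def)
    then show ?thesis
      using dilation_eqD(1)[OF dim_pos \<beta>[OF gens[OF i]], of b "a (x i)" \<alpha>] one[OF i] by simp
  qed
  moreover have "\<beta> (x 0) = 0\<^sub>v N"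
  proof -
    have "\<delta> (gen (1\<^sub>m N) (x 0)) = dilation N \<alpha> (0\<^sub>v N)"
      using \<delta> by (simp add: based_reps_def)
    then show ?thesis
      using dilation_eqD(2)[OF dim_pos \<beta>[OF gens[of 0]], of "0\<^sub>v N" "a (x 0)" \<alpha>] one[of 0] by simp
  qed
  moreover have "rvec \<delta> = blocks N n (\<lambda>i. \<beta> (x i))"
  proof (rule eq_vecI)
    fix u assume "u < dim_vec (blocks N n (\<lambda>i. \<beta> (x i)))"
    then have u: "u < n * N" by (simp add: blocks_def)
    then have "u div N + 1 \<le> n" by (simp add: less_mult_imp_div_less Suc_le_eq)
    then show "rvec \<delta> $ u = blocks N n (\<lambda>i. \<beta> (x i)) $ u"
      using u one[of "u div N + 1"] \<beta>[OF gens, of "u div N + 1"]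
      by (simp add: rep_vec_def blocks_def dilation_zero)
  qed (simp add: rep_vec_def blocks_def)
  ultimately have "rep_data \<alpha> a \<beta> \<and> rvec \<delta> = blocks N n (\<lambda>i. \<beta> (x i)) \<and>
    (\<forall>s\<in>S. \<forall>g\<in>carrier G. \<delta> (gen s g) = dilation N (a g) (s *\<^sub>v \<beta> g))"
    using \<phi> val unfolding rep_data_def by blast
  then show ?thesis by blast
qed

lemma based_rep_of_rep_data:
  assumes d: "rep_data \<alpha> a \<beta>"
  shows "\<exists>\<delta>\<in>reps \<alpha>. rvec \<delta> = blocks N n (\<lambda>i. \<beta> (x i))"
proof -
  note \<beta> = rep_dataD(5)[OF d]
  obtain \<delta> where \<delta>: "\<delta> \<in> S_reps \<inter> extensional (carrier P)"
    and val: "\<And>s g. s \<in> S \<Longrightarrow> g \<in> carrier G \<Longrightarrow> \<delta> (gen s g) = dilation N (a g) (s *\<^sub>v \<beta> g)"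
    by (rule S_rep_of_hom[OF rep_dataD(1)[OF d]]) blast
  have one: "\<delta> (gen (1\<^sub>m N) (x i)) = dilation N \<alpha> (\<beta> (x i))" if "i \<le> n" for i
    using val[OF S_one gens[OF that]] \<beta>[OF gens[OF that]] rep_dataD(2)[OF d that] by simp
  have "\<exists>b\<in>carrier_vec N. \<delta> (gen (1\<^sub>m N) (x i)) = dilation N \<alpha> b" if "i \<le> n" for i
    using one[OF that] \<beta>[OF gens[OF that]] by blast
  then have "\<delta> \<in> reps \<alpha>"
    using \<delta> one[of 0] rep_dataD(3)[OF d] by (simp add: based_reps_def)
  moreover have "rvec \<delta> = blocks N n (\<lambda>i. \<beta> (x i))"
  proof (rule eq_vecI)
    fix u assume "u < dim_vec (blocks N n (\<lambda>i. \<beta> (x i)))"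
    then have u: "u < n * N" by (simp add: blocks_def)
    then have "u div N + 1 \<le> n" by (simp add: less_mult_imp_div_less Suc_le_eq)
    then show "rvec \<delta> $ u = blocks N n (\<lambda>i. \<beta> (x i)) $ u"
      using u one[of "u div N + 1"] \<beta>[OF gens, of "u div N + 1"]
      by (simp add: rep_vec_def blocks_def dilation_zero)
  qed (simp add: rep_vec_def blocks_def)
  ultimately show ?thesis by blast
qed

text \<open>The vector fixes \<beta> at x_1, ..., x_n and basedness fixes it at x_0, so the two
  homomorphisms into \<open>K\<close> agree on all generators.\<close>

lemma rep_data_eqI:
  assumes d: "rep_data \<alpha> a \<beta>" and d': "rep_data \<alpha> a' \<beta>'"
    and eq: "blocks N n (\<lambda>i. \<beta> (x i)) = blocks N n (\<lambda>i. \<beta>' (x i))" and g: "g \<in> carrier G"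
  shows "a g = a' g \<and> \<beta> g = \<beta>' g"
proof -
  have "\<forall>i\<in>{1..n}. \<beta> (x i) = \<beta>' (x i)"
    using eq by (subst (asm) blocks_eq_iff) (simp_all add: gens rep_dataD(5)[OF d] rep_dataD(5)[OF d'])
  then have "\<beta> (x i) = \<beta>' (x i)" if "i \<le> n" for i
    using that rep_dataD(3)[OF d] rep_dataD(3)[OF d'] by (cases "i = 0") auto
  then have "(\<lambda>g. (a g, \<gamma> g, \<beta> g)) g = (\<lambda>g. (a' g, \<gamma> g, \<beta>' g)) g"
    by (intro has_presentation_hom_eqI[OF is_group twisted_dilations_group presentation
          rep_dataD(1)[OF d] rep_dataD(1)[OF d'] _ g]) (simp add: rep_dataD(2)[OF d] rep_dataD(2)[OF d'])
  then show ?thesis by simp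
qed

lemma rep_vec_image:
  assumes \<alpha>: "\<alpha> \<noteq> 0"
  shows "rvec ` reps \<alpha> = mat_kernel (M (inverse \<alpha>))"
proof (intro subset_antisym subsetI)
  fix v assume "v \<in> rvec ` reps \<alpha>"
  then obtain \<delta> where \<delta>: "\<delta> \<in> reps \<alpha>" "v = rvec \<delta>" by blast
  obtain a \<beta> where "rep_data \<alpha> a \<beta>" "rvec \<delta> = blocks N n (\<lambda>i. \<beta> (x i))"
    using rep_data_of_based_rep[OF \<delta>(1)] by blast
  then show "v \<in> mat_kernel (M (inverse \<alpha>))"
    using kernel_of_rep_data[OF \<alpha>] \<delta>(2) by simp
next
  fix v assume "v \<in> mat_kernel (M (inverse \<alpha>))"
  then obtain a \<beta> where "rep_data \<alpha> a \<beta>" "blocks N n (\<lambda>i. \<beta> (x i)) = v"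
    using rep_data_of_kernel[OF \<alpha>] by blast
  then obtain \<delta> where "\<delta> \<in> reps \<alpha>" "rvec \<delta> = v" using based_rep_of_rep_data[of \<alpha> a \<beta>] by auto
  then show "v \<in> rvec ` reps \<alpha>" by blast
qed

lemma rep_vec_inj: "inj_on rvec (reps \<alpha>)"
proof (rule inj_onI)
  fix \<delta> \<delta>' assume \<delta>: "\<delta> \<in> reps \<alpha>" "\<delta>' \<in> reps \<alpha>" and eq: "rvec \<delta> = rvec \<delta>'"
  obtain a \<beta> where 1: "rep_data \<alpha> a \<beta>" "rvec \<delta> = blocks N n (\<lambda>i. \<beta> (x i))"
    "\<forall>s\<in>S. \<forall>g\<in>carrier G. \<delta> (gen s g) = dilation N (a g) (s *\<^sub>v \<beta> g)"
    using rep_data_of_based_rep[OF \<delta>(1)] by blast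
  obtain a' \<beta>' where 2: "rep_data \<alpha> a' \<beta>'" "rvec \<delta>' = blocks N n (\<lambda>i. \<beta>' (x i))"
    "\<forall>s\<in>S. \<forall>g\<in>carrier G. \<delta>' (gen s g) = dilation N (a' g) (s *\<^sub>v \<beta>' g)"
    using rep_data_of_based_rep[OF \<delta>(2)] by blast
  have "a g = a' g \<and> \<beta> g = \<beta>' g" if "g \<in> carrier G" for g
    by (rule rep_data_eqI[OF 1(1) 2(1) _ that]) (use eq 1(2) 2(2) in simp)
  then have gen_eq: "\<delta> (gen s g) = \<delta>' (gen s g)" if "s \<in> S" "g \<in> carrier G" for s g
    using bspec[OF bspec[OF 1(3) that(1)] that(2)] bspec[OF bspec[OF 2(3) that(1)] that(2)] that by simp
  have hom: "\<delta> \<in> hom P D" "\<delta>' \<in> hom P D" using \<delta> by (auto simp: based_reps_def S_hom_def)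
  have "\<delta> C = \<delta>' C" if "C \<in> carrier P" for C
    by (rule P_hom_eqI[OF dilation_group_is_group hom gen_eq that])
  moreover have "\<delta> \<in> extensional (carrier P)" "\<delta>' \<in> extensional (carrier P)"
    using \<delta> by (auto simp: based_reps_def)
  ultimately show "\<delta> = \<delta>'" by (metis extensionalityI)
qed

text \<open>Multiplying \<beta> by \<open>c\<close> preserves its law, so by uniqueness of the data
  with a given vector the result is the data of \<open>\<delta>'\<close>.\<close>

lemma conjugate_reps_proportional:
  assumes \<delta>: "\<delta> \<in> reps \<alpha>" "\<delta>' \<in> reps \<alpha>" and c: "c \<noteq> 0" "rvec \<delta>' = c \<cdot>\<^sub>v rvec \<delta>"
  shows "conjugate_reps P D \<delta> \<delta>'"
proof -
  obtain a \<beta> where 1: "rep_data \<alpha> a \<beta>" "rvec \<delta> = blocks N n (\<lambda>i. \<beta> (x i))"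
    "\<forall>s\<in>S. \<forall>g\<in>carrier G. \<delta> (gen s g) = dilation N (a g) (s *\<^sub>v \<beta> g)"
    using rep_data_of_based_rep[OF \<delta>(1)] by blast
  obtain a' \<beta>' where 2: "rep_data \<alpha> a' \<beta>'" "rvec \<delta>' = blocks N n (\<lambda>i. \<beta>' (x i))"
    "\<forall>s\<in>S. \<forall>g\<in>carrier G. \<delta>' (gen s g) = dilation N (a' g) (s *\<^sub>v \<beta>' g)"
    using rep_data_of_based_rep[OF \<delta>(2)] by blast
  interpret D: group D by (rule dilation_group_is_group)
  note anz = rep_dataD(4)[OF 1(1)] and \<beta> = rep_dataD(5)[OF 1(1)]
    and cocycle = rep_dataD(6,7)[OF 1(1)]
  have "(\<lambda>g. (a g, \<gamma> g, c \<cdot>\<^sub>v \<beta> g)) \<in> hom G K"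
  proof (rule homI)
    fix g assume "g \<in> carrier G"
    then show "(a g, \<gamma> g, c \<cdot>\<^sub>v \<beta> g) \<in> carrier K" using \<beta> anz rep_GL by simp
  next
    fix g h assume gh: "g \<in> carrier G" "h \<in> carrier G"
    have "c \<cdot>\<^sub>v (a h \<cdot>\<^sub>v \<beta> g + \<gamma> g *\<^sub>v \<beta> h) = c \<cdot>\<^sub>v (a h \<cdot>\<^sub>v \<beta> g) + c \<cdot>\<^sub>v (\<gamma> g *\<^sub>v \<beta> h)"
      using gh \<beta> rep_carrier by (intro smult_add_distrib_vec[of _ N]) (auto intro!: mult_mat_vec_carrier)
    also have "\<dots> = a h \<cdot>\<^sub>v (c \<cdot>\<^sub>v \<beta> g) + \<gamma> g *\<^sub>v (c \<cdot>\<^sub>v \<beta> h)"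
      using mult_mat_vec[OF rep_carrier[OF gh(1)] \<beta>[OF gh(2)]] by (simp add: smult_smult_assoc mult.commute)
    finally show "(a (g \<otimes> h), \<gamma> (g \<otimes> h), c \<cdot>\<^sub>v \<beta> (g \<otimes> h)) =
        (a g, \<gamma> g, c \<cdot>\<^sub>v \<beta> g) \<otimes>\<^bsub>K\<^esub> (a h, \<gamma> h, c \<cdot>\<^sub>v \<beta> h)"
      using gh by (simp add: cocycle rep_mult)
  qed
  moreover have "c \<cdot>\<^sub>v \<beta> (x 0) = 0\<^sub>v N"
    using rep_dataD(3)[OF 1(1)] by (auto intro: eq_vecI)
  ultimately have "rep_data \<alpha> a (\<lambda>g. c \<cdot>\<^sub>v \<beta> g)"
    using rep_dataD(2)[OF 1(1)] by (simp add: rep_data_def)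
  moreover have "blocks N n (\<lambda>i. c \<cdot>\<^sub>v \<beta> (x i)) = blocks N n (\<lambda>i. \<beta>' (x i))"
    using c(2) 1(2) 2(2) \<beta> gens by (subst blocks_smult[OF dim_pos]) auto
  ultimately have eq: "a g = a' g \<and> c \<cdot>\<^sub>v \<beta> g = \<beta>' g" if "g \<in> carrier G" for g
    using rep_data_eqI[OF _ 2(1) _ that] by blast
  have zero: "z \<cdot>\<^sub>v 0\<^sub>v N = (0\<^sub>v N :: complex vec)" for z
    by (intro eq_vecI) auto
  \<comment> \<open>Read from left to right, conjugation sends z to z / c, then to \<mu> z / c + b,
    then to \<mu> z + c b: the ratio stays and the translation is scaled by
    \<open>c\<close>.\<close>
  define d where "d = dilation N c (0\<^sub>v N)"
  have d: "d \<in> carrier D" using c by (simp add: d_def dilation_closed)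
  have "inv\<^bsub>D\<^esub> d = dilation N (inverse c) (0\<^sub>v N)"
    using c by (intro D.inv_equality) (simp_all add: d_def dilation_mult dilation_closed dilation_one zero)
  then have conj: "inv\<^bsub>D\<^esub> d \<otimes>\<^bsub>D\<^esub> dilation N \<mu> b \<otimes>\<^bsub>D\<^esub> d = dilation N \<mu> (c \<cdot>\<^sub>v b)" if "b \<in> carrier_vec N" for \<mu> b
    using c that by (simp add: d_def dilation_mult zero field_simps)
  have hom: "\<delta> \<in> hom P D" "\<delta>' \<in> hom P D" using \<delta> by (auto simp: based_reps_def S_hom_def)
  have "(\<lambda>C. inv\<^bsub>D\<^esub> d \<otimes>\<^bsub>D\<^esub> \<delta> C \<otimes>\<^bsub>D\<^esub> d) \<in> hom P D"
  proof (rule homI)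
    fix C C' assume C: "C \<in> carrier P" "C' \<in> carrier P"
    then have m: "\<delta> C \<in> carrier D" "\<delta> C' \<in> carrier D" "\<delta> (C \<otimes>\<^bsub>P\<^esub> C') = \<delta> C \<otimes>\<^bsub>D\<^esub> \<delta> C'"
      using hom(1) by (auto simp: hom_def)
    have "d \<otimes>\<^bsub>D\<^esub> (inv\<^bsub>D\<^esub> d \<otimes>\<^bsub>D\<^esub> z) = z" if "z \<in> carrier D" for z
      using d that by (simp add: D.m_assoc[symmetric])
    then show "inv\<^bsub>D\<^esub> d \<otimes>\<^bsub>D\<^esub> \<delta> (C \<otimes>\<^bsub>P\<^esub> C') \<otimes>\<^bsub>D\<^esub> d =
        inv\<^bsub>D\<^esub> d \<otimes>\<^bsub>D\<^esub> \<delta> C \<otimes>\<^bsub>D\<^esub> d \<otimes>\<^bsub>D\<^esub> (inv\<^bsub>D\<^esub> d \<otimes>\<^bsub>D\<^esub> \<delta> C' \<otimes>\<^bsub>D\<^esub> d)"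
      using m d by (simp add: D.m_assoc)
  qed (use hom(1) d in \<open>auto simp: hom_def\<close>)
  moreover have "inv\<^bsub>D\<^esub> d \<otimes>\<^bsub>D\<^esub> \<delta> (gen s g) \<otimes>\<^bsub>D\<^esub> d = \<delta>' (gen s g)" if "s \<in> S" "g \<in> carrier G" for s g
  proof -
    have "\<delta>' (gen s g) = dilation N (a g) (s *\<^sub>v (c \<cdot>\<^sub>v \<beta> g))"
      using bspec[OF bspec[OF 2(3) that(1)] that(2)] eq[OF that(2)] by simp
    also have "s *\<^sub>v (c \<cdot>\<^sub>v \<beta> g) = c \<cdot>\<^sub>v (s *\<^sub>v \<beta> g)"
      by (rule mult_mat_vec[OF S_carrier[OF that(1)] \<beta>[OF that(2)]])
    finally show ?thesis
      using bspec[OF bspec[OF 1(3) that(1)] that(2)] conj mult_mat_vec_carrier[OF S_carrier[OF that(1)] \<beta>[OF that(2)]] by simp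
  qed
  ultimately have "inv\<^bsub>D\<^esub> d \<otimes>\<^bsub>D\<^esub> \<delta> C \<otimes>\<^bsub>D\<^esub> d = \<delta>' C" if "C \<in> carrier P" for C
    using P_hom_eqI[OF dilation_group_is_group, where \<delta> = "\<lambda>C. inv\<^bsub>D\<^esub> d \<otimes>\<^bsub>D\<^esub> \<delta> C \<otimes>\<^bsub>D\<^esub> d"] hom(2) that
    by blast
  then show ?thesis unfolding conjugate_reps_def using d by (intro bexI[of _ d] ballI) simp_all
qed

end

section \<open>The two assertions for the knot group\<close>

theorem theorem4p1:
  fixes k :: "(complex \<times> complex) set" and p :: "complex \<times> complex"
    and n N :: nat
    and x :: "nat \<Rightarrow> (real \<Rightarrow> complex \<times> complex) set"
    and \<rho> :: "nat \<Rightarrow> nat \<times> nat \<times> nat"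
    and \<pi> :: "(real \<Rightarrow> complex \<times> complex) set monoid"
    and \<gamma> :: "(real \<Rightarrow> complex \<times> complex) set \<Rightarrow> complex mat"
    and D :: "nat \<Rightarrow> laurent"
  assumes "knot k"
    and "\<pi> = fundamental_group (S3 - k) p"
    and "wirtinger_presentation k p n x \<rho>"
    and "N \<ge> 1"
    and "\<gamma> \<in> hom \<pi> (GL N)"
    and "twisted_polynomials N n (\<lambda>i. \<gamma> (x i)) \<rho> D"
  shows "(\<forall>\<alpha>. \<alpha> \<noteq> 0 \<longrightarrow>
            inj_on (rep_vec N \<pi> \<gamma> n x) (based_reps N \<pi> \<gamma> n x \<alpha>) \<and>
            is_linear_subspace (n * N) (rep_vec N \<pi> \<gamma> n x ` based_reps N \<pi> \<gamma> n x \<alpha>) \<and>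
            linear_dim (n * N) (rep_vec N \<pi> \<gamma> n x ` based_reps N \<pi> \<gamma> n x \<alpha>)
              = Max (insert 0 {r. r \<ge> 1 \<and> laurent_eval (D r) (inverse \<alpha>) = 0})) \<and>
         (\<forall>\<alpha> f. \<alpha> \<noteq> 0 \<and> irreducible f \<and> f dvd D 1 \<and> \<not> f dvd D 2 \<and>
            laurent_eval f (inverse \<alpha>) = 0 \<longrightarrow>
            (\<forall>\<delta>\<in>based_reps N \<pi> \<gamma> n x \<alpha>. \<forall>\<delta>'\<in>based_reps N \<pi> \<gamma> n x \<alpha>.
               rep_vec N \<pi> \<gamma> n x \<delta> \<noteq> 0\<^sub>v (n * N) \<and> rep_vec N \<pi> \<gamma> n x \<delta>' \<noteq> 0\<^sub>v (n * N) \<longrightarrow>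
               conjugate_reps (crowell_group \<pi> \<gamma>) (dilation_group N) \<delta> \<delta>'))"
proof -
  have pres: "has_presentation \<pi> {0..n} x (wirtinger_relators n \<rho>)"
    using assms(3) unfolding wirtinger_presentation_def assms(2) by (rule conjunct2)
  obtain c :: "real \<Rightarrow> complex \<times> real" and A s
    where arcs: "\<forall>l\<in>{1..n}. case \<rho> l of (i, j, k) \<Rightarrow>
      i \<le> n \<and> j \<le> n \<and> k \<le> n \<and> crossing_arcs c A (s l) i j k"
    using conjunct1[OF assms(3)[unfolded wirtinger_presentation_def]]
    by (elim exE conjE) (rule that)
  have bounds: "i \<le> n \<and> j \<le> n \<and> k \<le> n" if "l \<in> {1..n}" "\<rho> l = (i, j, k)" for l i j k
    using bspec[OF arcs that(1)] that(2) by simp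
  have group: "group \<pi>"
    using has_presentation_fundamental_group pres unfolding assms(2) .
  interpret wirtinger_rep \<pi> \<gamma> N n x \<rho>
    by (intro wirtinger_rep.intro matrix_rep.intro matrix_rep_axioms.intro wirtinger_rep_axioms.intro;
        fact group assms(4) assms(5) pres bounds)
  let ?dim = "\<lambda>\<alpha>. linear_dim (n * N) (mat_kernel (M (inverse \<alpha>)))"
  have zero_iff: "laurent_eval (D r) (inverse \<alpha>) = 0 \<longleftrightarrow> r \<le> ?dim \<alpha>" if "\<alpha> \<noteq> 0" "r \<ge> 1" for \<alpha> r
    unfolding linear_dim_def using that by (intro twisted_polynomial_eval_eq_0_iff assms(6)) auto
  show ?thesis
  proof (intro conjI allI impI ballI)
    fix \<alpha> :: complex assume \<alpha>: "\<alpha> \<noteq> 0"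
    show "inj_on rvec (reps \<alpha>)" by (rule rep_vec_inj)
    show "is_linear_subspace (n * N) (rvec ` reps \<alpha>)"
      unfolding is_linear_subspace_def rep_vec_image[OF \<alpha>]
      by (rule rank_nullity_mat(2)[OF eval_matrix_carrier])
    \<comment> \<open>The zeros occur exactly for r between 1 and the nullity. The inserted 0
      completes them to an initial segment and provides the value for the empty set.\<close>
    have "insert 0 {r. r \<ge> 1 \<and> laurent_eval (D r) (inverse \<alpha>) = 0} = {..?dim \<alpha>}"
      using zero_iff[OF \<alpha>] by auto
    moreover have "Max {..m} = m" for m :: nat by (rule Max_eqI) auto
    ultimately show "linear_dim (n * N) (rvec ` reps \<alpha>)
        = Max (insert 0 {r. r \<ge> 1 \<and> laurent_eval (D r) (inverse \<alpha>) = 0})"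
      unfolding rep_vec_image[OF \<alpha>] by simp
  next
    fix \<alpha> f \<delta> \<delta>'
    assume f: "\<alpha> \<noteq> 0 \<and> irreducible f \<and> f dvd D 1 \<and> \<not> f dvd D 2 \<and> laurent_eval f (inverse \<alpha>) = 0"
      and \<delta>: "\<delta> \<in> reps \<alpha>" "\<delta>' \<in> reps \<alpha>"
      and nz: "rvec \<delta> \<noteq> 0\<^sub>v (n * N) \<and> rvec \<delta>' \<noteq> 0\<^sub>v (n * N)"
    have \<alpha>: "\<alpha> \<noteq> 0" using f by simp
    \<comment> \<open>\<open>f\<close> is associated to the linear factor at \<alpha>^-1, so its
      absence from \<open>D 2\<close> means that \<open>D 2\<close> does not vanish there, and the
      nullity is below 2.\<close>
    have "laurent_eval (D 2) (inverse \<alpha>) \<noteq> 0"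
      using f irreducible_laurent_dvd_iff[of "inverse \<alpha>" f "D 2"] by simp
    then have "?dim \<alpha> \<le> 1" using zero_iff[OF \<alpha>, of 2] by simp
    moreover have "rvec \<delta> \<in> mat_kernel (M (inverse \<alpha>))" "rvec \<delta>' \<in> mat_kernel (M (inverse \<alpha>))"
      using \<delta> rep_vec_image[OF \<alpha>] by auto
    ultimately have "\<exists>c. c \<noteq> 0 \<and> rvec \<delta>' = c \<cdot>\<^sub>v rvec \<delta>"
      using nz[THEN conjunct1] nz[THEN conjunct2] unfolding linear_dim_def
      by (intro mat_kernel_proportional[OF eval_matrix_carrier]) simp_all
    then obtain c where "c \<noteq> 0" "rvec \<delta>' = c \<cdot>\<^sub>v rvec \<delta>" by blast
    then show "conjugate_reps (crowell_group \<pi> \<gamma>) (dilation_group N) \<delta> \<delta>'"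
      by (rule conjugate_reps_proportional[OF \<delta>])
  qed
qed

end
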